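(* Let $V$ be a finite nonempty set, let $G_1=(V,E_1)$ and $G_2=(V,E_2)$ be two unweighted undirected graphs on $V$, and let $p\ge 0$ be an integer. Let $P_1$ and $P_2$ be the $p$-dimensional persistence diagrams of the cliqueness complex filtrations of $G_1$ and $G_2$ respectively. Then $$B(P_1,P_2)\le D^U(G_1,G_2).$$
   Context: Graphs are finite, simple, undirected and unweighted. For two graphs on the same vertex set $V$, $D^U((V,E_1),(V,E_2))=\max_{i,j\in V}|\mathbb{1}_{E_1}((i,j))-\mathbb{1}_{E_2}((i,j))|\in\{0,1\}$, where $\mathbb{1}_E$ is the indicator function of the edge set $E$. Cliqueness complex filtration of a graph $G=(V,E_G)$. For $v\in V$ let $N(v)$ be its closed neighbourhood in $G$, i.e. $v$ together with all vertices adjacent to $v$. Let $E$ be the set of all unordered pairs of distinct elements of $V$, so $(V,E)$ is the complete graph on $V$, and define $C:E\to[0,1]$ by $$C((v_1,v_2))=\frac{|N(v_1)\cap N(v_2)|}{|N(v_1)\cup N(v_2)|}.$$ Let $K$ be the clique complex of $(V,E)$, i.e. the simplicial complex of all nonempty subsets of $V$. Define $f:K\to[0,1]$ as follows: if $\dim\sigma\ge1$, $f(\sigma)$ is the minimum of $C(e)$ over all edges $e\in E$ contained in $\sigma$; if $\sigma=\{v\}$, $f(\sigma)$ is the maximum of $C(e)$ over all edges $e\in E$ containing $v$, and $0$ if there are no such edges. Then $f(\sigma)\ge f(\tau)$ whenever $\sigma$ is a face of $\tau$. Order the simplices of $K$ totally as $\sigma_1,\dots,\sigma_m$ by decreasing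 value of $f$, breaking ties by increasing dimension and then arbitrarily, and set $K_0=\emptyset$, $K_i=K_{i-1}\cup\{\sigma_i\}$. The filtration is $(K_0,\dots,K_m)$. Persistent homology is simplicial homology (unreduced) with coefficients in a fixed field. For each $p$-dimensional persistent homology class born at $K_i$ and dying at $K_j$, the $p$-dimensional persistence diagram contains the point $(f(\sigma_i),f(\sigma_j))$, and for each class born at $K_i$ that never dies it contains $(f(\sigma_i),-\infty)$. Points $(a,b)$ thus satisfy $a\ge b$. (Up to points on the diagonal, this is the persistence diagram of the superlevel-set filtration $\{\sigma: f(\sigma)\ge t\}$, $t$ decreasing.) The bottleneck distance is $B(X,Y)=\inf_{\eta}\sup_{x\in X}\|x-\eta(x)\|_\infty$, where all diagonal points $(a,a)$ with infinite multiplicity are first added to both diagrams and $\eta$ ranges over bijections $X\to Y$; by convention $|(-\infty)-(-\infty)|=0$ and $|(-\infty)-a|=\infty$ for finite $a$. *)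

theory Defs
  imports
    "HOL-Analysis.Analysis"
    "HOL-Library.Function_Algebras"
    "HOL-Library.Set_Algebras"
    "HOL-Library.Multiset"
    "Graph_Theory.Pair_Digraph"
begin

section \<open>Graphs and the cliqueness function\<close>

text \<open>Finite simple undirected graphs are those satisfying \<open>pair_graph\<close>: an edge between
  \<open>u\<close> and \<open>v\<close> is the presence of both \<open>(u, v)\<close> and \<open>(v, u)\<close> in \<open>parcs\<close>.\<close>

definition graph_dist :: "'a pair_pre_digraph \<Rightarrow> 'a pair_pre_digraph \<Rightarrow> real" where
  "graph_dist G H =
     Max {\<bar>indicator (parcs G) (i, j) - indicator (parcs H) (i, j)\<bar> | i j.
            i \<in> pverts G \<and> j \<in> pverts G}"

definition closed_nbhd :: "'a pair_pre_digraph \<Rightarrow> 'a \<Rightarrow> 'a set" where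
  "closed_nbhd G v = insert v {w. (v, w) \<in> parcs G}"

definition complete_edges :: "'a set \<Rightarrow> 'a set set" where
  "complete_edges V = {{v, w} | v w. v \<in> V \<and> w \<in> V \<and> v \<noteq> w}"

definition cliqueness_edge :: "'a pair_pre_digraph \<Rightarrow> 'a set \<Rightarrow> real" where
  "cliqueness_edge G e =
     real (card (\<Inter>v\<in>e. closed_nbhd G v)) / real (card (\<Union>v\<in>e. closed_nbhd G v))"

definition full_complex :: "'a set \<Rightarrow> 'a set set" where
  "full_complex V = {\<sigma>. \<sigma> \<subseteq> V \<and> \<sigma> \<noteq> {}}"

text \<open>A simplex \<open>\<sigma>\<close> has dimension \<open>card \<sigma> - 1\<close>.\<close>

definition cliqueness :: "'a pair_pre_digraph \<Rightarrow> 'a set \<Rightarrow> real" where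
  "cliqueness G \<sigma> =
     (if card \<sigma> \<ge> 2 then Min (cliqueness_edge G ` {e \<in> complete_edges (pverts G). e \<subseteq> \<sigma>})
      else if {e \<in> complete_edges (pverts G). \<sigma> \<subseteq> e} = {} then 0
      else Max (cliqueness_edge G ` {e \<in> complete_edges (pverts G). \<sigma> \<subseteq> e}))"

text \<open>A simplexwise filtration is given by the list \<open>[\<sigma>\<^sub>1, \<dots>, \<sigma>\<^sub>m]\<close> of its simplices;
  its \<open>i\<close>-th complex consists of the first \<open>i\<close> of them.\<close>

definition cliqueness_order :: "'a pair_pre_digraph \<Rightarrow> 'a set list \<Rightarrow> bool" where
  "cliqueness_order G \<sigma>s \<longleftrightarrow>
     distinct \<sigma>s \<and> set \<sigma>s = full_complex (pverts G) \<and>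
     sorted_wrt (\<lambda>\<sigma> \<tau>. cliqueness G \<sigma> > cliqueness G \<tau> \<or>
                        cliqueness G \<sigma> = cliqueness G \<tau> \<and> card \<sigma> \<le> card \<tau>) \<sigma>s"

definition stage :: "'a set list \<Rightarrow> nat \<Rightarrow> 'a set set" where
  "stage \<sigma>s i = set (take i \<sigma>s)"

section \<open>Simplicial homology with field coefficients\<close>

text \<open>A chain is a function on oriented simplices. An ordering of the vertices of a simplex
  represents an oriented simplex, and transposing two vertices changes the sign of the value.
  The formal sum of oriented simplices \<open>a \<cdot> [v\<^sub>0, \<dots>, v\<^sub>p] + \<dots>\<close> corresponds to the alternating
  function with value \<open>a\<close> at \<open>[v\<^sub>0, \<dots>, v\<^sub>p]\<close>.\<close>

definition chains :: "'a set set \<Rightarrow> nat \<Rightarrow> ('a list \<Rightarrow> 'k::field) set" where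
  "chains K p =
     {c. (\<forall>vs. c vs \<noteq> 0 \<longrightarrow> length vs = p + 1 \<and> distinct vs \<and> set vs \<in> K) \<and>
         (\<forall>us v w ws. c (us @ v # w # ws) = - c (us @ w # v # ws))}"

text \<open>The coefficient of \<open>[v\<^sub>0, \<dots>, v\<^sub>i\<^sub>-\<^sub>1, v\<^sub>i\<^sub>+\<^sub>1, \<dots>, v\<^sub>p]\<close> in the boundary of
  \<open>[v\<^sub>0, \<dots>, v\<^sub>p]\<close> is \<open>(-1)\<^sup>i\<close>, the value of the latter (as an alternating function) at
  \<open>[v\<^sub>i, v\<^sub>0, \<dots>, v\<^sub>i\<^sub>-\<^sub>1, v\<^sub>i\<^sub>+\<^sub>1, \<dots>, v\<^sub>p]\<close>; hence the formula. The value at the empty list is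
  \<open>0\<close> because homology is unreduced.\<close>

definition boundary :: "('a list \<Rightarrow> 'k::field) \<Rightarrow> 'a list \<Rightarrow> 'k" where
  "boundary c = (\<lambda>vs. if vs = [] then 0 else (\<Sum>v | c (v # vs) \<noteq> 0. c (v # vs)))"

definition cycles :: "'a set set \<Rightarrow> nat \<Rightarrow> ('a list \<Rightarrow> 'k::field) set" where
  "cycles K p = {c \<in> chains K p. boundary c = 0}"

definition boundaries :: "'a set set \<Rightarrow> nat \<Rightarrow> ('a list \<Rightarrow> 'k::field) set" where
  "boundaries K p = boundary ` chains K (p + 1)"

definition homology :: "'a set set \<Rightarrow> nat \<Rightarrow> ('a list \<Rightarrow> 'k::field) set set" where
  "homology K p = (\<lambda>z. z +o boundaries K p) ` cycles K p"

text \<open>The map on homology induced by the inclusion of a subcomplex into \<open>L\<close> sends the coset of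
  a cycle modulo the boundaries of the subcomplex to its coset modulo the boundaries of \<open>L\<close>.\<close>

definition inclusion_map ::
    "'a set set \<Rightarrow> nat \<Rightarrow> ('a list \<Rightarrow> 'k::field) set \<Rightarrow> ('a list \<Rightarrow> 'k) set" where
  "inclusion_map L p \<gamma> = \<gamma> + boundaries L p"

section \<open>Persistence diagrams\<close>

definition persistent_image :: "'a set list \<Rightarrow> nat \<Rightarrow> nat \<Rightarrow> nat \<Rightarrow> ('a list \<Rightarrow> 'k::field) set set" where
  "persistent_image \<sigma>s p i j = inclusion_map (stage \<sigma>s j) p ` homology (stage \<sigma>s i) p"

definition born_at :: "'a set list \<Rightarrow> nat \<Rightarrow> ('a list \<Rightarrow> 'k::field) set \<Rightarrow> nat \<Rightarrow> bool" where
  "born_at \<sigma>s p \<gamma> i \<longleftrightarrow>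
     1 \<le> i \<and> i \<le> length \<sigma>s \<and> \<gamma> \<in> homology (stage \<sigma>s i) p \<and> \<gamma> \<notin> persistent_image \<sigma>s p (i - 1) i"

text \<open>A class \<open>\<gamma>\<close> born at stage \<open>i\<close> dies on entering stage \<open>j\<close> if it merges there with a class
  that is already present at stage \<open>i - 1\<close> (elder rule).\<close>

definition dies_at :: "'a set list \<Rightarrow> nat \<Rightarrow> ('a list \<Rightarrow> 'k::field) set \<Rightarrow> nat \<Rightarrow> nat \<Rightarrow> bool" where
  "dies_at \<sigma>s p \<gamma> i j \<longleftrightarrow>
     i < j \<and> j \<le> length \<sigma>s \<and>
     inclusion_map (stage \<sigma>s (j - 1)) p \<gamma> \<notin> persistent_image \<sigma>s p (i - 1) (j - 1) \<and>
     inclusion_map (stage \<sigma>s j) p \<gamma> \<in> persistent_image \<sigma>s p (i - 1) j"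

text \<open>Consecutive stages differ by a single simplex, so the homology of stage \<open>i\<close> modulo the
  image of that of stage \<open>i - 1\<close> has dimension at most one. Hence, up to nonzero scalars and
  older classes, at most one class is born at \<open>i\<close>, and it contributes a single point.
  Points arising from different index pairs are counted with multiplicity, even if they have
  the same coordinates. The argument of type \<open>'k itself\<close> is the coefficient field.\<close>

definition persistence_diagram ::
    "'k::field itself \<Rightarrow> nat \<Rightarrow> ('a set \<Rightarrow> real) \<Rightarrow> 'a set list \<Rightarrow> (real \<times> ereal) multiset" where
  "persistence_diagram _ p f \<sigma>s =
     image_mset (\<lambda>(i, j). (f (\<sigma>s ! (i - 1)), ereal (f (\<sigma>s ! (j - 1)))))
       (mset_set {(i, j). \<exists>\<gamma> :: ('a list \<Rightarrow> 'k) set. born_at \<sigma>s p \<gamma> i \<and> dies_at \<sigma>s p \<gamma> i j}) +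
     image_mset (\<lambda>i. (f (\<sigma>s ! (i - 1)), - \<infinity>))
       (mset_set {i. \<exists>\<gamma> :: ('a list \<Rightarrow> 'k) set. born_at \<sigma>s p \<gamma> i \<and> (\<nexists>j. dies_at \<sigma>s p \<gamma> i j)})"

section \<open>Bottleneck distance\<close>

text \<open>The case distinction is needed since \<open>(-\<infinity>) - (-\<infinity>) = \<infinity>\<close> for extended reals.\<close>

definition point_dist :: "real \<times> ereal \<Rightarrow> real \<times> ereal \<Rightarrow> ereal" where
  "point_dist x y =
     max (ereal \<bar>fst x - fst y\<bar>) (if snd x = snd y then 0 else \<bar>snd x - snd y\<bar>)"

text \<open>Copies of a point are distinguished by natural numbers; every diagonal point gets
  infinitely many copies.\<close>

definition with_diagonal :: "(real \<times> ereal) multiset \<Rightarrow> ((real \<times> ereal) \<times> nat) set" where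
  "with_diagonal X = {(x, n). n < count X x \<or> snd x = ereal (fst x)}"

definition bottleneck_dist :: "(real \<times> ereal) multiset \<Rightarrow> (real \<times> ereal) multiset \<Rightarrow> ereal" where
  "bottleneck_dist X Y =
     (INF \<eta> \<in> {\<eta>. bij_betw \<eta> (with_diagonal X) (with_diagonal Y)}.
        SUP x \<in> with_diagonal X. point_dist (fst x) (fst (\<eta> x)))"

end

theory Submission
  imports Defs
begin

text \<open>
  The distance between the graphs is \<open>0\<close> or \<open>1\<close>, and the two values need different arguments.

  If it is \<open>1\<close>, the diagrams may be arbitrarily different in their finite points, but the
  cliqueness has values in \<open>[0, 1]\<close>, so no two finite points are further than \<open>1\<close> apart, and
  any finite point may be matched with a diagonal point in the unit square. The points at
  infinity have to be matched with each other, at a cost of at most \<open>1\<close>. There are equally many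
  of them because their number is the dimension of the homology of the full complex, the common
  last stage of both filtrations.

  If it is \<open>0\<close>, the graphs are equal, but the two orders of the simplices may break ties
  differently. The off-diagonal points do not notice: with \<open>Z\<^sub>i\<close> and \<open>B\<^sub>j\<close> the cycles and
  boundaries of the stages, a class is born at \<open>i\<close> and dies at \<open>j\<close> exactly if \<open>j\<close> is the first
  index such that some boundary in \<open>B\<^sub>j\<close> is a cycle of stage \<open>i\<close> but not of stage \<open>i - 1\<close>
  (\<open>exists_birth_death_iff\<close>). One simplex enlarges the cycle space by at most one dimension
  (\<open>codim_cycles_insert\<close>), so for any subspace \<open>W\<close> the number of \<open>i \<le> n\<close> for which
  \<open>Z\<^sub>i \<inter> W\<close> properly contains \<open>Z\<^sub>i\<^sub>-\<^sub>1 \<inter> W\<close> is \<open>dim (Z\<^sub>n \<inter> W)\<close>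
  (\<open>card_new_cycles_upto\<close>). The multiplicity of an off-diagonal point \<open>(a, b)\<close> is therefore
  an alternating sum of four such dimensions, where only superlevel sets
  at \<open>a\<close> and \<open>b\<close> enter and the order of the simplices has disappeared
  (\<open>card_finite_pairs_at\<close>). A point with infinite second coordinate is treated in the same
  way, with the space of all functions in place of \<open>B\<^sub>j\<close>. The number of these points is the
  corresponding sum for the whole filtration, which settles the first case as well.
\<close>

section \<open>Counting the steps of a chain of subspaces\<close>

text \<open>For subspaces \<open>U \<subseteq> W\<close> this says that \<open>W / U\<close> has dimension at most one: every vector
  outside \<open>U\<close> generates the quotient.\<close>

definition (in vector_space) codim_le_one :: "'b set \<Rightarrow> 'b set \<Rightarrow> bool" where
  "codim_le_one U W \<longleftrightarrow> (\<forall>z\<in>W. \<forall>w\<in>W - U. \<exists>c. z - scale c w \<in> U)"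

lemma (in vector_space) codim_le_oneD:
  assumes "codim_le_one U W" "z \<in> W" "w \<in> W" "w \<notin> U"
  obtains c where "z - scale c w \<in> U"
  using assms unfolding codim_le_one_def by blast

lemma (in vector_space) dim_of_codim_one_step:
  assumes "subspace U" "subspace W" "U \<subseteq> W" "codim_le_one U W"
    and "finite S" "independent S" "span S = U" "w \<in> W" "w \<notin> U"
  shows "independent (insert w S)" "span (insert w S) = W" "card (insert w S) = Suc (card S)"
proof -
  show "independent (insert w S)"
    using assms(6,7,9) by (simp add: independent_insertI)
  show "card (insert w S) = Suc (card S)"
    using \<open>finite S\<close> span_superset[of S] assms(7,9)
    by (intro card_insert_disjoint) auto
  have "insert w S \<subseteq> W" using span_superset[of S] assms(3,7,8) by auto
  then have "span (insert w S) \<subseteq> W" using assms(2) by (rule span_minimal)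
  moreover have "z \<in> span (insert w S)" if "z \<in> W" for z
    using codim_le_oneD[OF assms(4) that assms(8,9)] assms(7) by (auto simp: span_insert)
  ultimately show "span (insert w S) = W" by blast
qed

text \<open>Every proper step of the chain adds one vector to a basis, so the number of proper steps
  up to a term of the chain can be read off that term alone.\<close>

lemma (in vector_space) card_proper_steps_eq_dim:
  fixes A :: "nat \<Rightarrow> 'b set"
  assumes A0: "A 0 = {0}"
    and sub: "\<And>i. i \<le> n \<Longrightarrow> subspace (A i)"
    and mono: "\<And>i. i < n \<Longrightarrow> A i \<subseteq> A (Suc i)"
    and codim: "\<And>i. i < n \<Longrightarrow> codim_le_one (A i) (A (Suc i))"
  shows "card {i \<in> {1..n}. \<not> A i \<subseteq> A (i - 1)} = dim (A n)"
proof -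
  have "k \<le> n \<Longrightarrow> \<exists>S. finite S \<and> independent S \<and> span S = A k \<and>
          card S = card {i \<in> {1..k}. \<not> A i \<subseteq> A (i - 1)}" for k
  proof (induction k)
    case 0
    show ?case by (rule exI[of _ "{}"]) (simp add: A0 independent_empty)
  next
    case (Suc k)
    then obtain S where S: "finite S" "independent S" "span S = A k"
      "card S = card {i \<in> {1..k}. \<not> A i \<subseteq> A (i - 1)}" by auto
    show ?case
    proof (cases "A (Suc k) \<subseteq> A k")
      case True
      then have "{i \<in> {1..Suc k}. \<not> A i \<subseteq> A (i - 1)} = {i \<in> {1..k}. \<not> A i \<subseteq> A (i - 1)}"
        by (auto simp: le_Suc_eq)
      moreover have "A (Suc k) = A k" using True mono[of k] Suc.prems by auto
      ultimately show ?thesis using S by auto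
    next
      case False
      then obtain w where w: "w \<in> A (Suc k)" "w \<notin> A k" by auto
      have "{i \<in> {1..Suc k}. \<not> A i \<subseteq> A (i - 1)}
          = insert (Suc k) {i \<in> {1..k}. \<not> A i \<subseteq> A (i - 1)}"
        using False by (auto simp: le_Suc_eq)
      then have "card {i \<in> {1..Suc k}. \<not> A i \<subseteq> A (i - 1)} = Suc (card S)"
        using S(4) by simp
      moreover note dim_of_codim_one_step[OF sub sub mono codim S(1-3) w]
      ultimately show ?thesis
        using Suc.prems S(1) by (intro exI[of _ "insert w S"]) auto
    qed
  qed
  from this[of n] show ?thesis using dim_eq_card by (metis order_refl span_span)
qed

text \<open>For cycles \<open>U \<subseteq> W\<close> of two consecutive stages and boundaries \<open>B' \<subseteq> B\<close>, the left-hand side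
  speaks of a homology class that is new in \<open>W\<close> and becomes old when \<open>B'\<close> grows to \<open>B\<close>. Since
  \<open>W / U\<close> has at most one dimension, a class that is new is only absorbed if the whole quotient
  is, so all that matters is whether the boundaries reach a cycle outside \<open>U\<close>.\<close>

lemma (in vector_space) exists_absorbed_iff:
  assumes "subspace U" "subspace W" "U \<subseteq> W" "codim_le_one U W"
    and "subspace B'" "subspace B" "B' \<subseteq> B"
  shows "(\<exists>z\<in>W. z \<notin> U + B' \<and> z \<in> U + B) \<longleftrightarrow> \<not> W \<inter> B \<subseteq> U \<and> W \<inter> B' \<subseteq> U"
proof
  assume "\<exists>z\<in>W. z \<notin> U + B' \<and> z \<in> U + B"
  then obtain z u b where z: "z \<in> W" "z \<notin> U + B'" "z = u + b" "u \<in> U" "b \<in> B"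
    by (auto simp: set_plus_def)
  have "b = z - u" using z by simp
  then have "b \<in> W" using z(1,4) assms(2,3) subspace_diff[of W z u] by blast
  moreover have "b \<notin> U"
  proof
    assume "b \<in> U"
    then have "z + 0 \<in> U + B'"
      using z assms by (intro set_plus_intro) (auto simp: subspace_add subspace_0)
    then show False using z by simp
  qed
  moreover have "w \<in> U" if w: "w \<in> W \<inter> B'" for w
  proof (rule ccontr)
    assume "w \<notin> U"
    then obtain c where "z - scale c w \<in> U"
      using codim_le_oneD[OF assms(4) z(1)] w by blast
    then have "(z - scale c w) + scale c w \<in> U + B'"
      using w assms by (intro set_plus_intro) (auto simp: subspace_scale)
    then show False using z by simp
  qed
  ultimately show "\<not> W \<inter> B \<subseteq> U \<and> W \<inter> B' \<subseteq> U" using z by blast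
next
  assume *: "\<not> W \<inter> B \<subseteq> U \<and> W \<inter> B' \<subseteq> U"
  then obtain z where z: "z \<in> W" "z \<in> B" "z \<notin> U" by auto
  have "0 + z \<in> U + B" using z assms by (intro set_plus_intro) (auto simp: subspace_0)
  moreover have "z \<notin> U + B'"
  proof
    assume "z \<in> U + B'"
    then obtain u b where b: "z = u + b" "u \<in> U" "b \<in> B'" by (auto simp: set_plus_def)
    then have "b = z - u" by simp
    then have "b \<in> W" using z(1) b(2) assms(2,3) subspace_diff[of W z u] by blast
    then have "b \<in> U" using * b by blast
    then show False using b z assms by (simp add: subspace_add)
  qed
  ultimately show "\<exists>z\<in>W. z \<notin> U + B' \<and> z \<in> U + B" using z by auto
qed

section \<open>Spaces of chains\<close>

interpretation chain: vector_space "\<lambda>(a::'k::field) (c::'a list \<Rightarrow> 'k) vs. a * c vs"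
  by unfold_locales (auto simp: fun_eq_iff algebra_simps)

lemma chains_mono: "K \<subseteq> L \<Longrightarrow> chains K p \<subseteq> chains L p"
  unfolding chains_def by auto

lemma chains_empty: "chains {} p = {0}"
  unfolding chains_def by (auto simp: fun_eq_iff)

lemma chains_support:
  "c \<in> chains K p \<Longrightarrow> c vs \<noteq> 0 \<Longrightarrow> length vs = p + 1 \<and> distinct vs \<and> set vs \<in> K"
  unfolding chains_def by blast

lemma chains_swap:
  "c \<in> chains K p \<Longrightarrow> c (us @ v # w # ws) = - c (us @ w # v # ws)"
  unfolding chains_def by blast

lemma chainsI:
  assumes "\<And>vs. c vs \<noteq> 0 \<Longrightarrow> length vs = p + 1 \<and> distinct vs \<and> set vs \<in> K"
    and "\<And>us v w ws. c (us @ v # w # ws) = - c (us @ w # v # ws)"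
  shows "c \<in> chains K p"
  unfolding chains_def using assms by blast

lemma subspace_chains: "chain.subspace (chains K p :: ('a list \<Rightarrow> 'k::field) set)"
  unfolding chain.subspace_def
proof (intro conjI ballI allI)
  show "0 \<in> chains K p" by (rule chainsI) simp_all
next
  fix x y :: "'a list \<Rightarrow> 'k" assume x: "x \<in> chains K p" and y: "y \<in> chains K p"
  show "x + y \<in> chains K p"
  proof (rule chainsI)
    fix vs assume "(x + y) vs \<noteq> 0"
    then have "x vs \<noteq> 0 \<or> y vs \<noteq> 0" by auto
    then show "length vs = p + 1 \<and> distinct vs \<and> set vs \<in> K"
      using chains_support[OF x] chains_support[OF y] by blast
  next
    fix us v w ws
    show "(x + y) (us @ v # w # ws) = - (x + y) (us @ w # v # ws)"
      using chains_swap[OF x, of us v w ws] chains_swap[OF y, of us v w ws] by simp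
  qed
next
  fix a and x :: "'a list \<Rightarrow> 'k" assume x: "x \<in> chains K p"
  show "(\<lambda>vs. a * x vs) \<in> chains K p"
  proof (rule chainsI)
    fix vs assume "a * x vs \<noteq> 0"
    then show "length vs = p + 1 \<and> distinct vs \<and> set vs \<in> K"
      using chains_support[OF x, of vs] by simp
  next
    fix us v w ws
    show "a * x (us @ v # w # ws) = - (a * x (us @ w # v # ws))"
      using chains_swap[OF x, of us v w ws] by simp
  qed
qed

text \<open>The definition of the boundary sums over a set that depends on the chain; summing over a
  fixed vertex set instead makes linearity evident.\<close>

lemma boundary_eq_sum:
  assumes "c \<in> chains K p" "finite V" "\<Union>K \<subseteq> V" "vs \<noteq> []"
  shows "boundary c vs = (\<Sum>v\<in>V. c (v # vs))"
proof -
  have "v \<in> V" if "c (v # vs) \<noteq> 0" for v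
  proof -
    have "set (v # vs) \<in> K" using chains_support[OF assms(1) that] by blast
    then show ?thesis using assms(3) by auto
  qed
  then show ?thesis
    using assms unfolding boundary_def by (auto intro!: sum.mono_neutral_left)
qed

lemma boundary_add:
  assumes "c \<in> chains K p" "d \<in> chains K p" "finite (\<Union>K)"
  shows "boundary (c + d) = boundary c + boundary d"
proof
  fix vs show "boundary (c + d) vs = (boundary c + boundary d) vs"
  proof (cases "vs = []")
    case True then show ?thesis by (simp add: boundary_def)
  next
    case False
    note b = boundary_eq_sum[OF _ assms(3) order_refl False, of _ p]
    have "c + d \<in> chains K p"
      by (rule chain.subspace_add[OF subspace_chains assms(1,2)])
    from b[OF this] b[OF assms(1)] b[OF assms(2)] show ?thesis by (simp add: sum.distrib)
  qed
qed

lemma boundary_scale: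
  assumes "c \<in> chains K p" "finite (\<Union>K)"
  shows "boundary (\<lambda>vs. a * c vs) = (\<lambda>vs. a * boundary c vs)"
proof
  fix vs show "boundary (\<lambda>vs. a * c vs) vs = a * boundary c vs"
  proof (cases "vs = []")
    case True then show ?thesis by (simp add: boundary_def)
  next
    case False
    note b = boundary_eq_sum[OF _ assms(2) order_refl False, of _ p]
    have "(\<lambda>vs. a * c vs) \<in> chains K p"
      by (rule chain.subspace_scale[OF subspace_chains assms(1)])
    from b[OF this] b[OF assms(1)] show ?thesis by (simp add: sum_distrib_left)
  qed
qed

lemma boundary_zero: "boundary 0 = 0"
  unfolding boundary_def by (auto simp: fun_eq_iff)

lemma cycles_mono: "K \<subseteq> L \<Longrightarrow> cycles K p \<subseteq> cycles L p"
  using chains_mono unfolding cycles_def by blast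

lemma boundaries_mono: "K \<subseteq> L \<Longrightarrow> boundaries K p \<subseteq> boundaries L p"
  unfolding boundaries_def by (simp add: chains_mono image_mono)

lemma cycles_empty: "cycles {} p = {0}"
  unfolding cycles_def by (auto simp: chains_empty boundary_zero)

lemma subspace_cycles:
  fixes K :: "'a set set"
  assumes "finite (\<Union>K)"
  shows "chain.subspace (cycles K p :: ('a list \<Rightarrow> 'k::field) set)"
  unfolding chain.subspace_def
proof (intro conjI ballI allI)
  show "0 \<in> cycles K p"
    unfolding cycles_def using chain.subspace_0[OF subspace_chains] boundary_zero by blast
next
  fix x y :: "'a list \<Rightarrow> 'k" assume "x \<in> cycles K p" "y \<in> cycles K p"
  then show "x + y \<in> cycles K p"
    using boundary_add[OF _ _ assms, of x p y] chain.subspace_add[OF subspace_chains, of x K p y]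
    by (simp add: cycles_def)
next
  fix a and x :: "'a list \<Rightarrow> 'k" assume x: "x \<in> cycles K p"
  then have "x \<in> chains K p" "boundary x = 0" by (auto simp: cycles_def)
  moreover have "(\<lambda>vs. a * x vs) \<in> chains K p"
    by (rule chain.subspace_scale[OF subspace_chains]) fact
  moreover have "boundary (\<lambda>vs. a * x vs) = 0"
    using boundary_scale[OF \<open>x \<in> chains K p\<close> assms, of a] \<open>boundary x = 0\<close>
    by (simp add: zero_fun_def)
  ultimately show "(\<lambda>vs. a * x vs) \<in> cycles K p" by (simp add: cycles_def)
qed

lemma subspace_boundaries:
  fixes K :: "'a set set"
  assumes "finite (\<Union>K)"
  shows "chain.subspace (boundaries K p :: ('a list \<Rightarrow> 'k::field) set)"
  unfolding chain.subspace_def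
proof (intro conjI ballI allI)
  show "0 \<in> boundaries K p"
    unfolding boundaries_def
    by (rule image_eqI[where x = 0])
      (simp_all only: boundary_zero chain.subspace_0[OF subspace_chains])
next
  fix x y :: "'a list \<Rightarrow> 'k" assume "x \<in> boundaries K p" "y \<in> boundaries K p"
  then obtain c d where cd: "c \<in> chains K (p + 1)" "d \<in> chains K (p + 1)"
    "x = boundary c" "y = boundary d" unfolding boundaries_def by blast
  then have "x + y = boundary (c + d)"
    using boundary_add[OF cd(1,2) assms] by simp
  moreover have "c + d \<in> chains K (p + 1)"
    by (rule chain.subspace_add[OF subspace_chains cd(1,2)])
  ultimately show "x + y \<in> boundaries K p" unfolding boundaries_def by blast
next
  fix a and x :: "'a list \<Rightarrow> 'k" assume "x \<in> boundaries K p"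
  then obtain c where c: "c \<in> chains K (p + 1)" "x = boundary c"
    unfolding boundaries_def by blast
  have "(\<lambda>vs. a * c vs) \<in> chains K (p + 1)"
    by (rule chain.subspace_scale[OF subspace_chains c(1)])
  then have "boundary (\<lambda>vs. a * c vs) \<in> boundaries K p" unfolding boundaries_def by (rule imageI)
  then show "(\<lambda>vs. a * x vs) \<in> boundaries K p"
    using boundary_scale[OF c(1) assms] c(2) by simp
qed

text \<open>Adjacent transpositions generate all permutations.\<close>

lemma alternating_zero_iff:
  fixes c :: "'a list \<Rightarrow> 'k::field"
  assumes alt: "\<And>us v w ws. c (us @ v # w # ws) = - c (us @ w # v # ws)"
    and "mset xs = mset ys"
  shows "c (us @ xs) = 0 \<longleftrightarrow> c (us @ ys) = 0"
  using assms(2)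
proof (induction xs arbitrary: us ys)
  case Nil
  then show ?case by simp
next
  case (Cons x xs)
  then have "x \<in> set ys" by (metis list.set_intros(1) mset_eq_setD)
  then obtain as bs where ys: "ys = as @ x # bs" by (meson split_list)
  have front: "c (us @ as @ x # bs) = 0 \<longleftrightarrow> c (us @ x # as @ bs) = 0" for us
  proof (induction as arbitrary: us)
    case (Cons a as)
    have "c (us @ a # x # as @ bs) = 0 \<longleftrightarrow> c (us @ x # a # as @ bs) = 0"
      using alt[of us a x "as @ bs"] by simp
    then show ?case using Cons[of "us @ [a]"] by simp
  qed simp
  have "mset xs = mset (as @ bs)" using Cons.prems ys by simp
  from Cons.IH[OF this, of "us @ [x]"] show ?case using front ys by simp
qed

text \<open>A cycle that is not supported in \<open>K\<close> has a nonzero coefficient at \<open>\<sigma>\<close>, and an alternating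
  function has only one free value on the orderings of \<open>\<sigma>\<close>. So a suitable multiple of it
  cancels \<open>\<sigma>\<close> from any other cycle.\<close>

lemma codim_cycles_insert:
  fixes K :: "'a set set"
  assumes "finite (\<Union>K)" "finite \<sigma>"
  shows "chain.codim_le_one (cycles K p) (cycles (insert \<sigma> K) p :: ('a list \<Rightarrow> 'k::field) set)"
  unfolding chain.codim_le_one_def
proof (intro ballI)
  fix z w :: "'a list \<Rightarrow> 'k"
  assume z: "z \<in> cycles (insert \<sigma> K) p" and w: "w \<in> cycles (insert \<sigma> K) p - cycles K p"
  then have "w \<in> chains (insert \<sigma> K) p" "w \<notin> chains K p" by (auto simp: cycles_def)
  then obtain vs where vs: "w vs \<noteq> 0" "length vs = p + 1" "distinct vs" "set vs = \<sigma>"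
    using chainsI[of w p K] chains_support[of w _ p] chains_swap[of w _ p]
    by (metis insert_iff)
  \<comment> \<open>The factor makes \<open>u\<close> vanish at the ordering \<open>vs\<close> of \<open>\<sigma>\<close>, hence at every ordering.\<close>
  define u where "u = z - (\<lambda>us. (z vs / w vs) * w us)"
  have u: "u \<in> cycles (insert \<sigma> K) p"
  proof -
    have "finite (\<Union>(insert \<sigma> K))" using assms by simp
    note sub = subspace_cycles[OF this, of p]
    show ?thesis
      unfolding u_def
      by (rule chain.subspace_diff[OF sub z chain.subspace_scale[OF sub]]) (use w in simp)
  qed
  then have uc: "u \<in> chains (insert \<sigma> K) p" by (simp add: cycles_def)
  have "u vs = 0" using vs by (simp add: u_def)
  have "u \<in> chains K p"
  proof (rule chainsI)
    fix us assume us: "u us \<noteq> 0"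
    note supp = chains_support[OF uc us]
    have "set us \<noteq> \<sigma>"
    proof
      assume "set us = \<sigma>"
      then have "mset us = mset vs"
        using vs supp set_eq_iff_mset_eq_distinct[of us vs] by simp
      then have "u us = 0"
        using alternating_zero_iff[of u us vs "[]", OF chains_swap[OF uc]] \<open>u vs = 0\<close> by simp
      then show False using us by simp
    qed
    then show "length us = p + 1 \<and> distinct us \<and> set us \<in> K" using supp by simp
  qed (rule chains_swap[OF uc])
  then have "u \<in> cycles K p" using u by (simp add: cycles_def)
  then show "\<exists>c. z - (\<lambda>us. c * w us) \<in> cycles K p" unfolding u_def by blast
qed

section \<open>Births and deaths in terms of cycles and boundaries\<close>

lemma stage_mono: "i \<le> j \<Longrightarrow> stage \<sigma>s i \<subseteq> stage \<sigma>s j"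
  unfolding stage_def by (rule set_take_subset_set_take)

lemma stage_subset: "stage \<sigma>s i \<subseteq> set \<sigma>s"
  unfolding stage_def by (rule set_take_subset)

lemma finite_Union_stage: "finite (\<Union>(set \<sigma>s)) \<Longrightarrow> finite (\<Union>(stage \<sigma>s i))"
  using Union_mono[OF stage_subset] finite_subset by metis

lemma stage_Suc: "i < length \<sigma>s \<Longrightarrow> stage \<sigma>s (Suc i) = insert (\<sigma>s ! i) (stage \<sigma>s i)"
  unfolding stage_def by (simp add: take_Suc_conv_app_nth)

lemma coset_plus_larger_subspace:
  assumes "chain.subspace B" "chain.subspace B'" "B \<subseteq> B'"
  shows "(z +o B) + B' = z +o B'"
proof -
  have "B + B' = B'"
  proof
    show "B + B' \<subseteq> B'"
      using assms by (auto simp: set_plus_def intro: chain.subspace_add)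
    have "0 + b \<in> B + B'" if "b \<in> B'" for b
      using that assms(1) by (intro set_plus_intro chain.subspace_0)
    then show "B' \<subseteq> B + B'" by auto
  qed
  then show ?thesis by (simp add: set_plus_rearrange2 [symmetric] set_plus_rearrange3)
qed

text \<open>Here \<open>Z\<close> will be the cycles of an earlier stage, so that a condition on cosets becomes one on
  a representing cycle.\<close>

lemma coset_in_coset_image_iff:
  assumes "chain.subspace B"
  shows "z +o B \<in> (\<lambda>z. z +o B) ` Z \<longleftrightarrow> z \<in> Z + B"
proof
  assume "z +o B \<in> (\<lambda>z. z +o B) ` Z"
  then obtain z' where "z' \<in> Z" "z +o B = z' +o B" by auto
  moreover have "z + 0 \<in> z +o B" using assms by (intro set_plus_intro2 chain.subspace_0)
  ultimately show "z \<in> Z + B" by (auto simp: elt_set_plus_def set_plus_def)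
next
  assume "z \<in> Z + B"
  then obtain z' b where z: "z' \<in> Z" "b \<in> B" "z = z' + b" by (auto simp: set_plus_def)
  have "z +o B = z' +o B"
  proof (intro equalityI subsetI)
    fix x assume "x \<in> z +o B"
    then obtain d where d: "d \<in> B" "x = z + d" by (auto simp: elt_set_plus_def)
    have "z' + (b + d) \<in> z' +o B"
      using z d assms by (intro set_plus_intro2 chain.subspace_add)
    then show "x \<in> z' +o B" using z d by (simp add: add.assoc)
  next
    fix x assume "x \<in> z' +o B"
    then obtain d where d: "d \<in> B" "x = z' + d" by (auto simp: elt_set_plus_def)
    have "z + (d - b) \<in> z +o B"
      using z d assms by (intro set_plus_intro2 chain.subspace_diff)
    then show "x \<in> z +o B" using z d by (simp add: algebra_simps)
  qed
  then show "z +o B \<in> (\<lambda>z. z +o B) ` Z" using z by blast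
qed

lemma inclusion_map_coset:
  fixes z :: "'a list \<Rightarrow> 'k::field"
  assumes "finite (\<Union>L)" "K \<subseteq> L"
  shows "inclusion_map L p (z +o boundaries K p) = z +o boundaries L p"
proof -
  have "finite (\<Union>K)" using assms by (meson Union_mono finite_subset)
  then show ?thesis
    unfolding inclusion_map_def
    using assms by (intro coset_plus_larger_subspace subspace_boundaries boundaries_mono)
qed

lemma coset_in_persistent_image_iff:
  fixes z :: "'a list \<Rightarrow> 'k::field"
  assumes "finite (\<Union>(set \<sigma>s))" "i \<le> j"
  shows "z +o boundaries (stage \<sigma>s j) p \<in> persistent_image \<sigma>s p i j
    \<longleftrightarrow> z \<in> cycles (stage \<sigma>s i) p + boundaries (stage \<sigma>s j) p"
proof -
  note fin = finite_Union_stage[OF assms(1)]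
  have "persistent_image \<sigma>s p i j
      = (\<lambda>z. z +o boundaries (stage \<sigma>s j) p) ` (cycles (stage \<sigma>s i) p :: ('a list \<Rightarrow> 'k) set)"
    unfolding persistent_image_def homology_def image_image
    by (simp add: inclusion_map_coset[OF fin stage_mono[OF assms(2)]])
  then show ?thesis
    using coset_in_coset_image_iff[OF subspace_boundaries[OF fin]] by simp
qed

lemma born_and_dies_at_coset_iff:
  fixes z :: "'a list \<Rightarrow> 'k::field"
  assumes fin: "finite (\<Union>(set \<sigma>s))" and z: "z \<in> cycles (stage \<sigma>s i) p"
  shows "born_at \<sigma>s p (z +o boundaries (stage \<sigma>s i) p) i \<longleftrightarrow>
           1 \<le> i \<and> i \<le> length \<sigma>s \<and> z \<notin> cycles (stage \<sigma>s (i - 1)) p + boundaries (stage \<sigma>s i) p"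
    and "dies_at \<sigma>s p (z +o boundaries (stage \<sigma>s i) p) i j \<longleftrightarrow>
           i < j \<and> j \<le> length \<sigma>s \<and>
           z \<notin> cycles (stage \<sigma>s (i - 1)) p + boundaries (stage \<sigma>s (j - 1)) p \<and>
           z \<in> cycles (stage \<sigma>s (i - 1)) p + boundaries (stage \<sigma>s j) p"
proof -
  have "z +o boundaries (stage \<sigma>s i) p \<in> homology (stage \<sigma>s i) p"
    using z unfolding homology_def by blast
  then show "born_at \<sigma>s p (z +o boundaries (stage \<sigma>s i) p) i \<longleftrightarrow>
      1 \<le> i \<and> i \<le> length \<sigma>s \<and> z \<notin> cycles (stage \<sigma>s (i - 1)) p + boundaries (stage \<sigma>s i) p"
    unfolding born_at_def by (simp add: coset_in_persistent_image_iff[OF fin])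
  have "inclusion_map (stage \<sigma>s k) p (z +o boundaries (stage \<sigma>s i) p)
      = z +o boundaries (stage \<sigma>s k) p" if "i \<le> k" for k
    by (rule inclusion_map_coset[OF finite_Union_stage[OF fin] stage_mono[OF that]])
  then show "dies_at \<sigma>s p (z +o boundaries (stage \<sigma>s i) p) i j \<longleftrightarrow>
      i < j \<and> j \<le> length \<sigma>s \<and>
      z \<notin> cycles (stage \<sigma>s (i - 1)) p + boundaries (stage \<sigma>s (j - 1)) p \<and>
      z \<in> cycles (stage \<sigma>s (i - 1)) p + boundaries (stage \<sigma>s j) p"
    unfolding dies_at_def by (cases "i < j") (simp_all add: coset_in_persistent_image_iff[OF fin])
qed

lemma born_at_imp_coset:
  assumes "born_at \<sigma>s p \<gamma> i"
  obtains z where "z \<in> cycles (stage \<sigma>s i) p" "\<gamma> = z +o boundaries (stage \<sigma>s i) p"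
  using assms unfolding born_at_def homology_def by blast

text \<open>The set \<open>W\<close> will be a space of boundaries or the space of all functions. In the latter case
  the condition says that stage \<open>i\<close> has more cycles than stage \<open>i - 1\<close>.\<close>

definition new_cycle_in :: "'a set list \<Rightarrow> nat \<Rightarrow> ('a list \<Rightarrow> 'k::field) set \<Rightarrow> nat \<Rightarrow> bool" where
  "new_cycle_in \<sigma>s p W i \<longleftrightarrow> \<not> cycles (stage \<sigma>s i) p \<inter> W \<subseteq> cycles (stage \<sigma>s (i - 1)) p"

lemma codim_cycles_stage:
  assumes fin: "finite (\<Union>(set \<sigma>s))" and i: "i < length \<sigma>s"
  shows "chain.codim_le_one (cycles (stage \<sigma>s i) p)
           (cycles (stage \<sigma>s (Suc i)) p :: ('a list \<Rightarrow> 'k::field) set)"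
proof -
  have "\<sigma>s ! i \<subseteq> \<Union>(set \<sigma>s)" using nth_mem[OF i] by blast
  then show ?thesis
    unfolding stage_Suc[OF i]
    by (intro codim_cycles_insert finite_Union_stage[OF fin] finite_subset[OF _ fin])
qed

lemma sum_cycles_mono:
  "j \<le> k \<Longrightarrow> Z + boundaries (stage \<sigma>s j) p \<subseteq> Z + boundaries (stage \<sigma>s k) p"
  by (intro set_plus_mono2 order_refl boundaries_mono stage_mono)

lemma exists_new_class_iff:
  fixes B B' :: "('a list \<Rightarrow> 'k::field) set"
  assumes fin: "finite (\<Union>(set \<sigma>s))" and i: "1 \<le> i" "i \<le> length \<sigma>s"
    and "chain.subspace B'" "chain.subspace B" "B' \<subseteq> B"
  shows "(\<exists>z\<in>cycles (stage \<sigma>s i) p.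
           z \<notin> cycles (stage \<sigma>s (i - 1)) p + B' \<and> z \<in> cycles (stage \<sigma>s (i - 1)) p + B)
    \<longleftrightarrow> new_cycle_in \<sigma>s p B i \<and> \<not> new_cycle_in \<sigma>s p B' i"
proof -
  have pred: "i - 1 < length \<sigma>s" "Suc (i - 1) = i" using i by simp_all
  have "chain.codim_le_one (cycles (stage \<sigma>s (i - 1)) p)
      (cycles (stage \<sigma>s i) p :: ('a list \<Rightarrow> 'k) set)"
    by (rule codim_cycles_stage[OF fin pred(1), unfolded pred(2)])
  then show ?thesis
    unfolding new_cycle_in_def not_not
    using assms
    by (intro chain.exists_absorbed_iff subspace_cycles finite_Union_stage cycles_mono stage_mono)
      simp_all
qed

text \<open>Passing to representing cycles turns birth and death into the left-hand side of
  \<open>exists_new_class_iff\<close>. The class in question survives until \<open>j - 1\<close>, hence is new at \<open>i\<close>, so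
  the condition of being born at \<open>i\<close> is implied.\<close>

lemma exists_birth_death_iff:
  assumes fin: "finite (\<Union>(set \<sigma>s))"
  shows "(\<exists>\<gamma> :: ('a list \<Rightarrow> 'k::field) set. born_at \<sigma>s p \<gamma> i \<and> dies_at \<sigma>s p \<gamma> i j) \<longleftrightarrow>
    1 \<le> i \<and> i < j \<and> j \<le> length \<sigma>s \<and>
    new_cycle_in \<sigma>s p (boundaries (stage \<sigma>s j) p :: ('a list \<Rightarrow> 'k) set) i \<and>
    \<not> new_cycle_in \<sigma>s p (boundaries (stage \<sigma>s (j - 1)) p :: ('a list \<Rightarrow> 'k) set) i"
    (is "?L \<longleftrightarrow> _")
proof -
  have "?L \<longleftrightarrow> 1 \<le> i \<and> i < j \<and> j \<le> length \<sigma>s \<and>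
    (\<exists>z\<in>cycles (stage \<sigma>s i) p. (z :: 'a list \<Rightarrow> 'k)
        \<notin> cycles (stage \<sigma>s (i - 1)) p + boundaries (stage \<sigma>s (j - 1)) p \<and>
        z \<in> cycles (stage \<sigma>s (i - 1)) p + boundaries (stage \<sigma>s j) p)"
    (is "_ \<longleftrightarrow> ?R")
  proof
    assume ?L
    then obtain \<gamma> :: "('a list \<Rightarrow> 'k) set" where g: "born_at \<sigma>s p \<gamma> i" "dies_at \<sigma>s p \<gamma> i j"
      by blast
    from born_at_imp_coset[OF g(1)] obtain z
      where z: "z \<in> cycles (stage \<sigma>s i) p" "\<gamma> = z +o boundaries (stage \<sigma>s i) p" .
    show ?R
      using g z(1) born_and_dies_at_coset_iff[OF fin z(1)] unfolding z(2) by blast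
  next
    assume R: ?R
    then obtain z :: "'a list \<Rightarrow> 'k" where z: "z \<in> cycles (stage \<sigma>s i) p"
      "z \<notin> cycles (stage \<sigma>s (i - 1)) p + boundaries (stage \<sigma>s (j - 1)) p"
      "z \<in> cycles (stage \<sigma>s (i - 1)) p + boundaries (stage \<sigma>s j) p" by blast
    have "i < j" using R by blast
    then have "i \<le> j - 1" by arith
    then have "z \<notin> cycles (stage \<sigma>s (i - 1)) p + boundaries (stage \<sigma>s i) p"
      using z(2) sum_cycles_mono by blast
    then show ?L
      using R z born_and_dies_at_coset_iff[OF fin z(1)]
      by (intro exI[of _ "z +o boundaries (stage \<sigma>s i) p"]) simp
  qed
  also have "\<dots> \<longleftrightarrow> 1 \<le> i \<and> i < j \<and> j \<le> length \<sigma>s \<and>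
    new_cycle_in \<sigma>s p (boundaries (stage \<sigma>s j) p :: ('a list \<Rightarrow> 'k) set) i \<and>
    \<not> new_cycle_in \<sigma>s p (boundaries (stage \<sigma>s (j - 1)) p :: ('a list \<Rightarrow> 'k) set) i"
  proof (intro conj_cong refl)
    assume "1 \<le> i" "i < j" "j \<le> length \<sigma>s"
    then show "(\<exists>z\<in>cycles (stage \<sigma>s i) p. (z :: 'a list \<Rightarrow> 'k)
        \<notin> cycles (stage \<sigma>s (i - 1)) p + boundaries (stage \<sigma>s (j - 1)) p \<and>
        z \<in> cycles (stage \<sigma>s (i - 1)) p + boundaries (stage \<sigma>s j) p) \<longleftrightarrow>
      new_cycle_in \<sigma>s p (boundaries (stage \<sigma>s j) p :: ('a list \<Rightarrow> 'k) set) i \<and>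
      \<not> new_cycle_in \<sigma>s p (boundaries (stage \<sigma>s (j - 1)) p :: ('a list \<Rightarrow> 'k) set) i"
      by (intro exists_new_class_iff fin subspace_boundaries finite_Union_stage
          boundaries_mono stage_mono) simp_all
  qed
  finally show ?thesis .
qed

text \<open>A class is immortal if and only if it is not absorbed by the boundaries of the last stage.
  With the space of all functions as the larger one of the two spaces, which absorbs every
  class, \<open>exists_new_class_iff\<close> applies again.\<close>

lemma exists_immortal_iff:
  assumes fin: "finite (\<Union>(set \<sigma>s))"
  shows "(\<exists>\<gamma> :: ('a list \<Rightarrow> 'k::field) set. born_at \<sigma>s p \<gamma> i \<and> (\<nexists>j. dies_at \<sigma>s p \<gamma> i j)) \<longleftrightarrow>
    1 \<le> i \<and> i \<le> length \<sigma>s \<and> new_cycle_in \<sigma>s p (UNIV :: ('a list \<Rightarrow> 'k) set) i \<and>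
    \<not> new_cycle_in \<sigma>s p (boundaries (set \<sigma>s) p :: ('a list \<Rightarrow> 'k) set) i"
    (is "?L \<longleftrightarrow> _")
proof -
  let ?Z = "cycles (stage \<sigma>s (i - 1)) p :: ('a list \<Rightarrow> 'k) set"
  have last: "stage \<sigma>s (length \<sigma>s) = set \<sigma>s" by (simp add: stage_def)
  have "?L \<longleftrightarrow> 1 \<le> i \<and> i \<le> length \<sigma>s \<and>
    (\<exists>z\<in>cycles (stage \<sigma>s i) p. z \<notin> ?Z + boundaries (set \<sigma>s) p)" (is "_ \<longleftrightarrow> ?R")
  proof
    assume ?L
    then obtain \<gamma> :: "('a list \<Rightarrow> 'k) set"
      where g: "born_at \<sigma>s p \<gamma> i" "\<And>j. \<not> dies_at \<sigma>s p \<gamma> i j" by blast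
    from born_at_imp_coset[OF g(1)] obtain z
      where z: "z \<in> cycles (stage \<sigma>s i) p" "\<gamma> = z +o boundaries (stage \<sigma>s i) p" .
    note iff = born_and_dies_at_coset_iff[OF fin z(1), folded z(2)]
    have i: "1 \<le> i" "i \<le> length \<sigma>s" "z \<notin> ?Z + boundaries (stage \<sigma>s i) p"
      using g(1) iff(1) by auto
    have "z \<notin> ?Z + boundaries (stage \<sigma>s j) p" if "i \<le> j" "j \<le> length \<sigma>s" for j
      using that
    proof (induction j rule: dec_induct)
      case base
      then show ?case using i by simp
    next
      case (step j)
      then show ?case using g(2)[of "Suc j"] iff(2)[of "Suc j"] by simp
    qed
    from this[of "length \<sigma>s"] show ?R using i z(1) last by auto
  next
    assume R: ?R
    then obtain z :: "'a list \<Rightarrow> 'k" where z: "z \<in> cycles (stage \<sigma>s i) p"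
      "z \<notin> ?Z + boundaries (set \<sigma>s) p" by blast
    have *: "z \<notin> ?Z + boundaries (stage \<sigma>s j) p" if "j \<le> length \<sigma>s" for j
      using z(2) sum_cycles_mono[OF that, of ?Z \<sigma>s p] last by auto
    then show ?L
      using R z born_and_dies_at_coset_iff[OF fin z(1)]
      by (intro exI[of _ "z +o boundaries (stage \<sigma>s i) p"]) simp
  qed
  also have "\<dots> \<longleftrightarrow> 1 \<le> i \<and> i \<le> length \<sigma>s \<and> new_cycle_in \<sigma>s p (UNIV :: ('a list \<Rightarrow> 'k) set) i \<and>
    \<not> new_cycle_in \<sigma>s p (boundaries (set \<sigma>s) p :: ('a list \<Rightarrow> 'k) set) i"
  proof (intro conj_cong refl)
    assume i: "1 \<le> i" "i \<le> length \<sigma>s"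
    \<comment> \<open>Every class lies in this sum, so the second condition in \<open>exists_new_class_iff\<close> is void.\<close>
    have "0 + z \<in> ?Z + UNIV" for z
      by (intro set_plus_intro chain.subspace_0 subspace_cycles finite_Union_stage fin) simp
    then have "?Z + UNIV = UNIV" by auto
    then show "(\<exists>z\<in>cycles (stage \<sigma>s i) p. z \<notin> ?Z + boundaries (set \<sigma>s) p) \<longleftrightarrow>
      new_cycle_in \<sigma>s p (UNIV :: ('a list \<Rightarrow> 'k) set) i \<and>
      \<not> new_cycle_in \<sigma>s p (boundaries (set \<sigma>s) p :: ('a list \<Rightarrow> 'k) set) i"
      using exists_new_class_iff[OF fin i subspace_boundaries[OF fin] chain.subspace_UNIV
          subset_UNIV, where ?'k = 'k, of p p] by simp
  qed
  finally show ?thesis .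
qed

section \<open>Counting points of the diagram\<close>

lemma new_cycle_in_mono: "W' \<subseteq> W \<Longrightarrow> new_cycle_in \<sigma>s p W' i \<Longrightarrow> new_cycle_in \<sigma>s p W i"
  unfolding new_cycle_in_def by blast

text \<open>The spaces \<open>Z\<^sub>i \<inter> W\<close> form a chain that starts at \<open>{0}\<close> and has steps of codimension at most
  one, because intersecting with \<open>W\<close> does not increase codimensions.\<close>

lemma card_new_cycles_upto:
  fixes W :: "('a list \<Rightarrow> 'k::field) set"
  assumes fin: "finite (\<Union>(set \<sigma>s))" and n: "n \<le> length \<sigma>s" and W: "chain.subspace W"
  shows "card {i \<in> {1..n}. new_cycle_in \<sigma>s p W i} = chain.dim (cycles (stage \<sigma>s n) p \<inter> W)"
proof -
  let ?A = "\<lambda>i. cycles (stage \<sigma>s i) p \<inter> W"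
  have "card {i \<in> {1..n}. \<not> ?A i \<subseteq> ?A (i - 1)} = chain.dim (?A n)"
  proof (rule chain.card_proper_steps_eq_dim)
    have "stage \<sigma>s 0 = {}" by (simp add: stage_def)
    then show "?A 0 = {0}" using chain.subspace_0[OF W] by (simp add: cycles_empty)
    show "chain.subspace (?A i)" for i
      by (intro chain.subspace_inter subspace_cycles finite_Union_stage fin W)
    show "?A i \<subseteq> ?A (Suc i)" for i
      by (intro Int_mono cycles_mono stage_mono) simp_all
    fix i assume "i < n"
    then have "i < length \<sigma>s" using n by simp
    show "chain.codim_le_one (?A i) (?A (Suc i))"
      unfolding chain.codim_le_one_def
    proof (intro ballI)
      fix z w assume z: "z \<in> ?A (Suc i)" and w: "w \<in> ?A (Suc i) - ?A i"
      then obtain c where c: "z - (\<lambda>vs. c * w vs) \<in> cycles (stage \<sigma>s i) p"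
        using chain.codim_le_oneD[OF codim_cycles_stage[OF fin \<open>i < length \<sigma>s\<close>], of z p w]
        by blast
      have "z - (\<lambda>vs. c * w vs) \<in> W"
        by (rule chain.subspace_diff[OF W _ chain.subspace_scale[OF W]]) (use z w in simp_all)
      with c show "\<exists>c. z - (\<lambda>vs. c * w vs) \<in> ?A i" by blast
    qed
  qed
  moreover have "\<not> ?A i \<subseteq> ?A (i - 1) \<longleftrightarrow> new_cycle_in \<sigma>s p W i" for i
    unfolding new_cycle_in_def by blast
  ultimately show ?thesis by simp
qed

text \<open>For \<open>K' \<subseteq> K\<close> and \<open>W' \<subseteq> W\<close> this is the inclusion-exclusion formula for the number of births
  on the way from \<open>K'\<close> to \<open>K\<close> that are absorbed by \<open>W\<close> but not by \<open>W'\<close>.\<close>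

definition pair_multiplicity :: "nat \<Rightarrow> 'a set set \<Rightarrow> 'a set set \<Rightarrow>
    ('a list \<Rightarrow> 'k::field) set \<Rightarrow> ('a list \<Rightarrow> 'k) set \<Rightarrow> nat" where
  "pair_multiplicity p K' K W' W =
     (chain.dim (cycles K p \<inter> W) - chain.dim (cycles K' p \<inter> W)) -
     (chain.dim (cycles K p \<inter> W') - chain.dim (cycles K' p \<inter> W'))"

lemma card_births_between:
  fixes W W' :: "('a list \<Rightarrow> 'k::field) set"
  assumes fin: "finite (\<Union>(set \<sigma>s))" and n: "n' \<le> n" "n \<le> length \<sigma>s"
    and W: "chain.subspace W" "chain.subspace W'" "W' \<subseteq> W"
  shows "card {i \<in> {n'<..n}. new_cycle_in \<sigma>s p W i \<and> \<not> new_cycle_in \<sigma>s p W' i}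
    = pair_multiplicity p (stage \<sigma>s n') (stage \<sigma>s n) W' W"
proof -
  have between: "card {i \<in> {n'<..n}. new_cycle_in \<sigma>s p W i}
      = chain.dim (cycles (stage \<sigma>s n) p \<inter> W) - chain.dim (cycles (stage \<sigma>s n') p \<inter> W)"
    if "chain.subspace W" for W :: "('a list \<Rightarrow> 'k) set"
  proof -
    have "{i \<in> {n'<..n}. new_cycle_in \<sigma>s p W i}
        = {i \<in> {1..n}. new_cycle_in \<sigma>s p W i} - {i \<in> {1..n'}. new_cycle_in \<sigma>s p W i}"
      by auto
    moreover have "{i \<in> {1..n'}. new_cycle_in \<sigma>s p W i} \<subseteq> {i \<in> {1..n}. new_cycle_in \<sigma>s p W i}"
      using n by auto
    ultimately show ?thesis
      using card_new_cycles_upto[OF fin _ that] n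
      by (simp add: card_Diff_subset del: atLeastAtMost_iff)
  qed
  have "{i \<in> {n'<..n}. new_cycle_in \<sigma>s p W i \<and> \<not> new_cycle_in \<sigma>s p W' i}
      = {i \<in> {n'<..n}. new_cycle_in \<sigma>s p W i} - {i \<in> {n'<..n}. new_cycle_in \<sigma>s p W' i}"
    by auto
  moreover have "{i \<in> {n'<..n}. new_cycle_in \<sigma>s p W' i} \<subseteq> {i \<in> {n'<..n}. new_cycle_in \<sigma>s p W i}"
    using new_cycle_in_mono[OF W(3)] by auto
  ultimately show ?thesis
    by (simp add: card_Diff_subset between W pair_multiplicity_def del: greaterThanAtMost_iff)
qed

text \<open>For fixed \<open>i\<close> a condition that is monotone in \<open>j\<close> starts to hold at most once.\<close>

lemma card_first_times:
  fixes P :: "nat \<Rightarrow> nat \<Rightarrow> bool"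
  assumes mono: "\<And>i j k. j \<le> k \<Longrightarrow> P i j \<Longrightarrow> P i k" and "n' \<le> n"
  shows "card {(i, j). i \<in> I \<and> j \<in> {n'<..n} \<and> P i j \<and> \<not> P i (j - 1)}
    = card {i \<in> I. P i n \<and> \<not> P i n'}"
proof (rule bij_betw_same_card[of fst])
  have uniq: "j = k" if "P i j" "\<not> P i (j - 1)" "P i k" "\<not> P i (k - 1)" for i j k
  proof (rule antisym; rule ccontr)
    assume "\<not> j \<le> k"
    then show False using mono[of k "j - 1" i] that by simp
  next
    assume "\<not> k \<le> j"
    then show False using mono[of j "k - 1" i] that by simp
  qed
  have ex: "\<exists>j\<in>{n'<..n}. P i j \<and> \<not> P i (j - 1)" if "P i n" "\<not> P i n'" for i
  proof
    let ?j = "LEAST j. P i j"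
    have j: "P i ?j" using that(1) by (rule LeastI)
    have "n' < ?j" using mono[of ?j n' i] j that by (meson not_le)
    moreover have "?j \<le> n" using that(1) by (rule Least_le)
    ultimately show "?j \<in> {n'<..n}" by simp
    have "?j - 1 < ?j" using \<open>n' < ?j\<close> by simp
    then show "P i ?j \<and> \<not> P i (?j - 1)" using j not_less_Least by blast
  qed
  show "bij_betw fst {(i, j). i \<in> I \<and> j \<in> {n'<..n} \<and> P i j \<and> \<not> P i (j - 1)}
      {i \<in> I. P i n \<and> \<not> P i n'}"
    unfolding bij_betw_def
  proof (intro conjI)
    show "inj_on fst {(i, j). i \<in> I \<and> j \<in> {n'<..n} \<and> P i j \<and> \<not> P i (j - 1)}"
      using uniq by (auto simp: inj_on_def)
    show "fst ` {(i, j). i \<in> I \<and> j \<in> {n'<..n} \<and> P i j \<and> \<not> P i (j - 1)}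
        = {i \<in> I. P i n \<and> \<not> P i n'}"
    proof (intro equalityI subsetI)
      fix i assume "i \<in> fst ` {(i, j). i \<in> I \<and> j \<in> {n'<..n} \<and> P i j \<and> \<not> P i (j - 1)}"
      then obtain j where j: "i \<in> I" "j \<in> {n'<..n}" "P i j" "\<not> P i (j - 1)" by auto
      then have "j \<le> n" "n' \<le> j - 1" by auto
      then show "i \<in> {i \<in> I. P i n \<and> \<not> P i n'}"
        using j mono[of j n i] mono[of n' "j - 1" i] by blast
    next
      fix i assume "i \<in> {i \<in> I. P i n \<and> \<not> P i n'}"
      then show "i \<in> fst ` {(i, j). i \<in> I \<and> j \<in> {n'<..n} \<and> P i j \<and> \<not> P i (j - 1)}"
        using ex[of i] by (force simp: image_iff)
    qed
  qed
qed

text \<open>Every superlevel set of a decreasing function is a stage. This is how quantities that refer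
  to stages become independent of the order of the simplices.\<close>

lemma prefix_of_upward_closed:
  assumes "sorted_wrt (\<lambda>\<sigma> \<tau>. f \<sigma> \<ge> (f \<tau> :: real)) \<sigma>s"
    and Q: "\<And>x y. Q x \<Longrightarrow> x \<le> y \<Longrightarrow> Q y"
  obtains n where "n \<le> length \<sigma>s" "stage \<sigma>s n = {\<sigma> \<in> set \<sigma>s. Q (f \<sigma>)}"
    "\<And>i. 1 \<le> i \<Longrightarrow> i \<le> length \<sigma>s \<Longrightarrow> Q (f (\<sigma>s ! (i - 1))) \<longleftrightarrow> i \<le> n"
proof
  let ?n = "length (takeWhile (\<lambda>\<sigma>. Q (f \<sigma>)) \<sigma>s)"
  show len: "?n \<le> length \<sigma>s" by (rule length_takeWhile_le)
  have nth: "Q (f (\<sigma>s ! k)) \<longleftrightarrow> k < ?n" if "k < length \<sigma>s" for k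
  proof
    assume "k < ?n"
    then show "Q (f (\<sigma>s ! k))"
      using set_takeWhileD[of "\<sigma>s ! k" "\<lambda>\<sigma>. Q (f \<sigma>)"] takeWhile_nth nth_mem by metis
  next
    assume "Q (f (\<sigma>s ! k))"
    show "k < ?n"
    proof (rule ccontr)
      assume "\<not> k < ?n"
      then have "?n \<le> k" "?n < length \<sigma>s" using that by auto
      then have "f (\<sigma>s ! ?n) \<ge> f (\<sigma>s ! k)"
        using assms(1) that by (cases "?n = k") (auto simp: sorted_wrt_iff_nth_less)
      then show False
        using Q[OF \<open>Q (f (\<sigma>s ! k))\<close>] nth_length_takeWhile[OF \<open>?n < length \<sigma>s\<close>] by blast
    qed
  qed
  show "stage \<sigma>s ?n = {\<sigma> \<in> set \<sigma>s. Q (f \<sigma>)}"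
  proof (intro equalityI subsetI)
    fix \<sigma> assume "\<sigma> \<in> stage \<sigma>s ?n"
    then have "\<sigma> \<in> set (takeWhile (\<lambda>\<sigma>. Q (f \<sigma>)) \<sigma>s)"
      unfolding stage_def by (simp only: takeWhile_eq_take [symmetric])
    then show "\<sigma> \<in> {\<sigma> \<in> set \<sigma>s. Q (f \<sigma>)}" by (auto dest: set_takeWhileD)
  next
    fix \<sigma> assume "\<sigma> \<in> {\<sigma> \<in> set \<sigma>s. Q (f \<sigma>)}"
    then obtain k where k: "k < length \<sigma>s" "\<sigma> = \<sigma>s ! k" "Q (f (\<sigma>s ! k))"
      by (auto simp: in_set_conv_nth)
    then have "k < ?n" using nth by blast
    then have "take ?n \<sigma>s ! k = \<sigma>" "k < length (take ?n \<sigma>s)" using k by simp_all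
    then show "\<sigma> \<in> stage \<sigma>s ?n" unfolding stage_def by (metis nth_mem)
  qed
  show "Q (f (\<sigma>s ! (i - 1))) \<longleftrightarrow> i \<le> ?n" if "1 \<le> i" "i \<le> length \<sigma>s" for i
    using nth[of "i - 1"] that by auto
qed

lemma count_image_mset_set:
  assumes "finite A"
  shows "count (image_mset f (mset_set A)) y = card {x \<in> A. f x = y}"
  using assms by (simp add: count_image_mset' Collect_conj_eq Int_commute eq_commute)

abbreviation superlevel :: "('a set \<Rightarrow> real) \<Rightarrow> 'a set set \<Rightarrow> real \<Rightarrow> 'a set set" where
  "superlevel f K t \<equiv> {\<sigma> \<in> K. t \<le> f \<sigma>}"

abbreviation strict_superlevel :: "('a set \<Rightarrow> real) \<Rightarrow> 'a set set \<Rightarrow> real \<Rightarrow> 'a set set" where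
  "strict_superlevel f K t \<equiv> {\<sigma> \<in> K. t < f \<sigma>}"

definition finite_pairs :: "'k::field itself \<Rightarrow> nat \<Rightarrow> 'a set list \<Rightarrow> (nat \<times> nat) set" where
  "finite_pairs _ p \<sigma>s = {(i, j). \<exists>\<gamma> :: ('a list \<Rightarrow> 'k) set. born_at \<sigma>s p \<gamma> i \<and> dies_at \<sigma>s p \<gamma> i j}"

definition immortal_births :: "'k::field itself \<Rightarrow> nat \<Rightarrow> 'a set list \<Rightarrow> nat set" where
  "immortal_births _ p \<sigma>s =
     {i. \<exists>\<gamma> :: ('a list \<Rightarrow> 'k) set. born_at \<sigma>s p \<gamma> i \<and> (\<nexists>j. dies_at \<sigma>s p \<gamma> i j)}"

lemma persistence_diagram_eq:
  "persistence_diagram TYPE('k::field) p f \<sigma>s =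
     image_mset (\<lambda>(i, j). (f (\<sigma>s ! (i - 1)), ereal (f (\<sigma>s ! (j - 1)))))
       (mset_set (finite_pairs TYPE('k) p \<sigma>s)) +
     image_mset (\<lambda>i. (f (\<sigma>s ! (i - 1)), - \<infinity>)) (mset_set (immortal_births TYPE('k) p \<sigma>s))"
  unfolding persistence_diagram_def finite_pairs_def immortal_births_def ..

lemma finite_pairs_bounds:
  "(i, j) \<in> finite_pairs TYPE('k::field) p \<sigma>s \<Longrightarrow> 1 \<le> i \<and> i < j \<and> j \<le> length \<sigma>s"
  unfolding finite_pairs_def born_at_def dies_at_def by blast

lemma immortal_births_bounds:
  "i \<in> immortal_births TYPE('k::field) p \<sigma>s \<Longrightarrow> 1 \<le> i \<and> i \<le> length \<sigma>s"
  unfolding immortal_births_def born_at_def by blast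

lemma finite_finite_pairs: "finite (finite_pairs TYPE('k::field) p \<sigma>s)"
  by (rule finite_subset[of _ "{..length \<sigma>s} \<times> {..length \<sigma>s}"])
    (use finite_pairs_bounds in fastforce)+

lemma finite_immortal_births: "finite (immortal_births TYPE('k::field) p \<sigma>s)"
  by (rule finite_subset[of _ "{..length \<sigma>s}"]) (use immortal_births_bounds in fastforce)+

text \<open>The births with value \<open>a\<close> and the deaths with value \<open>b\<close> each form an interval of indices. As
  \<open>b < a\<close>, the first interval lies before the second one, so the requirement that a birth
  precedes its death is automatic.\<close>

lemma card_finite_pairs_at:
  assumes fin: "finite (\<Union>(set \<sigma>s))" and sorted: "sorted_wrt (\<lambda>\<sigma> \<tau>. f \<sigma> \<ge> f \<tau>) \<sigma>s"
    and "b < a"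
  shows "card {(i, j) \<in> finite_pairs TYPE('k::field) p \<sigma>s.
             f (\<sigma>s ! (i - 1)) = a \<and> f (\<sigma>s ! (j - 1)) = b}
    = pair_multiplicity p (strict_superlevel f (set \<sigma>s) a) (superlevel f (set \<sigma>s) a)
        (boundaries (strict_superlevel f (set \<sigma>s) b) p)
        (boundaries (superlevel f (set \<sigma>s) b) p :: ('a list \<Rightarrow> 'k) set)"
proof -
  obtain ia where ia: "ia \<le> length \<sigma>s" "stage \<sigma>s ia = superlevel f (set \<sigma>s) a"
    "\<And>i. 1 \<le> i \<Longrightarrow> i \<le> length \<sigma>s \<Longrightarrow> a \<le> f (\<sigma>s ! (i - 1)) \<longleftrightarrow> i \<le> ia"
    by (rule prefix_of_upward_closed[OF sorted, of "\<lambda>x. a \<le> x"]) auto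
  obtain ia' where ia': "ia' \<le> length \<sigma>s" "stage \<sigma>s ia' = strict_superlevel f (set \<sigma>s) a"
    "\<And>i. 1 \<le> i \<Longrightarrow> i \<le> length \<sigma>s \<Longrightarrow> a < f (\<sigma>s ! (i - 1)) \<longleftrightarrow> i \<le> ia'"
    by (rule prefix_of_upward_closed[OF sorted, of "\<lambda>x. a < x"]) auto
  obtain ib where ib: "ib \<le> length \<sigma>s" "stage \<sigma>s ib = superlevel f (set \<sigma>s) b"
    "\<And>i. 1 \<le> i \<Longrightarrow> i \<le> length \<sigma>s \<Longrightarrow> b \<le> f (\<sigma>s ! (i - 1)) \<longleftrightarrow> i \<le> ib"
    by (rule prefix_of_upward_closed[OF sorted, of "\<lambda>x. b \<le> x"]) auto
  obtain ib' where ib': "ib' \<le> length \<sigma>s" "stage \<sigma>s ib' = strict_superlevel f (set \<sigma>s) b"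
    "\<And>i. 1 \<le> i \<Longrightarrow> i \<le> length \<sigma>s \<Longrightarrow> b < f (\<sigma>s ! (i - 1)) \<longleftrightarrow> i \<le> ib'"
    by (rule prefix_of_upward_closed[OF sorted, of "\<lambda>x. b < x"]) auto
  have at_a: "f (\<sigma>s ! (i - 1)) = a \<longleftrightarrow> i \<in> {ia'<..ia}" if "1 \<le> i" "i \<le> length \<sigma>s" for i
    using ia(3)[OF that] ia'(3)[OF that] by auto
  have at_b: "f (\<sigma>s ! (i - 1)) = b \<longleftrightarrow> i \<in> {ib'<..ib}" if "1 \<le> i" "i \<le> length \<sigma>s" for i
    using ib(3)[OF that] ib'(3)[OF that] by auto
  \<comment> \<open>Inclusions between the superlevel sets order the corresponding indices.\<close>
  have le: "n' \<le> n" if "n' \<le> length \<sigma>s" and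
    "\<And>i. 1 \<le> i \<Longrightarrow> i \<le> length \<sigma>s \<Longrightarrow> i \<le> n' \<Longrightarrow> i \<le> n" for n n'
    using that(2)[of n'] that(1) by (cases "n' = 0") auto
  have "ia' \<le> ia" by (rule le[OF ia'(1)]) (use ia(3) ia'(3) in fastforce)
  have "ib' \<le> ib" by (rule le[OF ib'(1)]) (use ib(3) ib'(3) in fastforce)
  have "ia \<le> ib'" by (rule le[OF ia(1)]) (use ia(3) ib'(3) \<open>b < a\<close> in fastforce)
  define P where "P i j \<longleftrightarrow> new_cycle_in \<sigma>s p (boundaries (stage \<sigma>s j) p :: ('a list \<Rightarrow> 'k) set) i"
    for i j
  have P_mono: "P i k" if "j \<le> k" "P i j" for i j k
    using that unfolding P_def by (meson new_cycle_in_mono boundaries_mono stage_mono)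
  have pairs_iff: "(i, j) \<in> finite_pairs TYPE('k) p \<sigma>s \<longleftrightarrow>
      1 \<le> i \<and> i < j \<and> j \<le> length \<sigma>s \<and> P i j \<and> \<not> P i (j - 1)" for i j
    unfolding finite_pairs_def P_def using exists_birth_death_iff[OF fin, where ?'k = 'k] by simp
  have "{(i, j) \<in> finite_pairs TYPE('k) p \<sigma>s. f (\<sigma>s ! (i - 1)) = a \<and> f (\<sigma>s ! (j - 1)) = b}
      = {(i, j). i \<in> {ia'<..ia} \<and> j \<in> {ib'<..ib} \<and> P i j \<and> \<not> P i (j - 1)}"
  proof (intro set_eqI, clarify)
    fix i j
    show "(i, j) \<in> {(i, j) \<in> finite_pairs TYPE('k) p \<sigma>s.
          f (\<sigma>s ! (i - 1)) = a \<and> f (\<sigma>s ! (j - 1)) = b}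
      \<longleftrightarrow> (i, j) \<in> {(i, j). i \<in> {ia'<..ia} \<and> j \<in> {ib'<..ib} \<and> P i j \<and> \<not> P i (j - 1)}"
    proof (cases "1 \<le> i \<and> i < j \<and> j \<le> length \<sigma>s")
      case True
      then have "f (\<sigma>s ! (i - 1)) = a \<longleftrightarrow> i \<in> {ia'<..ia}" "f (\<sigma>s ! (j - 1)) = b \<longleftrightarrow> j \<in> {ib'<..ib}"
        using at_a at_b by simp_all
      with True show ?thesis unfolding mem_Collect_eq prod.case pairs_iff by blast
    next
      case False
      then show ?thesis using \<open>ia \<le> ib'\<close> ib(1) by (auto simp: pairs_iff)
    qed
  qed
  also have "card \<dots> = card {i \<in> {ia'<..ia}. P i ib \<and> \<not> P i ib'}"
    by (rule card_first_times[OF P_mono \<open>ib' \<le> ib\<close>])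
  also have "\<dots> = pair_multiplicity p (stage \<sigma>s ia') (stage \<sigma>s ia)
      (boundaries (stage \<sigma>s ib') p) (boundaries (stage \<sigma>s ib) p :: ('a list \<Rightarrow> 'k) set)"
    unfolding P_def
    by (intro card_births_between fin \<open>ia' \<le> ia\<close> ia(1) subspace_boundaries finite_Union_stage
        boundaries_mono stage_mono \<open>ib' \<le> ib\<close>)
  finally show ?thesis by (simp only: ia(2) ia'(2) ib(2) ib'(2))
qed

lemma immortal_births_eq:
  assumes "finite (\<Union>(set \<sigma>s))"
  shows "immortal_births TYPE('k::field) p \<sigma>s = {i \<in> {0<..length \<sigma>s}.
    new_cycle_in \<sigma>s p (UNIV :: ('a list \<Rightarrow> 'k) set) i \<and>
    \<not> new_cycle_in \<sigma>s p (boundaries (set \<sigma>s) p :: ('a list \<Rightarrow> 'k) set) i}"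
  unfolding immortal_births_def exists_immortal_iff[OF assms] by auto

lemma card_immortal_births_at:
  assumes fin: "finite (\<Union>(set \<sigma>s))" and sorted: "sorted_wrt (\<lambda>\<sigma> \<tau>. f \<sigma> \<ge> f \<tau>) \<sigma>s"
  shows "card {i \<in> immortal_births TYPE('k::field) p \<sigma>s. f (\<sigma>s ! (i - 1)) = a}
    = pair_multiplicity p (strict_superlevel f (set \<sigma>s) a) (superlevel f (set \<sigma>s) a)
        (boundaries (set \<sigma>s) p) (UNIV :: ('a list \<Rightarrow> 'k) set)"
proof -
  obtain ia where ia: "ia \<le> length \<sigma>s" "stage \<sigma>s ia = superlevel f (set \<sigma>s) a"
    "\<And>i. 1 \<le> i \<Longrightarrow> i \<le> length \<sigma>s \<Longrightarrow> a \<le> f (\<sigma>s ! (i - 1)) \<longleftrightarrow> i \<le> ia"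
    by (rule prefix_of_upward_closed[OF sorted, of "\<lambda>x. a \<le> x"]) auto
  obtain ia' where ia': "ia' \<le> length \<sigma>s" "stage \<sigma>s ia' = strict_superlevel f (set \<sigma>s) a"
    "\<And>i. 1 \<le> i \<Longrightarrow> i \<le> length \<sigma>s \<Longrightarrow> a < f (\<sigma>s ! (i - 1)) \<longleftrightarrow> i \<le> ia'"
    by (rule prefix_of_upward_closed[OF sorted, of "\<lambda>x. a < x"]) auto
  have at_a: "f (\<sigma>s ! (i - 1)) = a \<longleftrightarrow> i \<in> {ia'<..ia}" if "1 \<le> i" "i \<le> length \<sigma>s" for i
    using ia(3)[OF that] ia'(3)[OF that] by auto
  have "ia' \<le> ia"
    using ia(3)[of ia'] ia'(3)[of ia'] ia'(1) by (cases "ia' = 0") auto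
  have "{i \<in> immortal_births TYPE('k) p \<sigma>s. f (\<sigma>s ! (i - 1)) = a} = {i \<in> {ia'<..ia}.
      new_cycle_in \<sigma>s p (UNIV :: ('a list \<Rightarrow> 'k) set) i \<and>
      \<not> new_cycle_in \<sigma>s p (boundaries (set \<sigma>s) p :: ('a list \<Rightarrow> 'k) set) i}"
    (is "?A = ?B")
  proof (intro set_eqI)
    fix i
    show "i \<in> ?A \<longleftrightarrow> i \<in> ?B"
    proof (cases "1 \<le> i \<and> i \<le> length \<sigma>s")
      case True
      then have "f (\<sigma>s ! (i - 1)) = a \<longleftrightarrow> i \<in> {ia'<..ia}" "i \<in> {0<..length \<sigma>s}"
        using at_a by simp_all
      then show ?thesis unfolding immortal_births_eq[OF fin] mem_Collect_eq by blast
    next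
      case False
      then show ?thesis using ia(1) unfolding immortal_births_eq[OF fin] by auto
    qed
  qed
  also have "card \<dots> = pair_multiplicity p (stage \<sigma>s ia') (stage \<sigma>s ia)
        (boundaries (set \<sigma>s) p) (UNIV :: ('a list \<Rightarrow> 'k) set)"
    by (intro card_births_between fin \<open>ia' \<le> ia\<close> ia(1) subspace_boundaries
        chain.subspace_UNIV subset_UNIV)
  finally show ?thesis by (simp only: ia(2) ia'(2))
qed

lemma card_immortal_births:
  assumes "finite (\<Union>(set \<sigma>s))"
  shows "card (immortal_births TYPE('k::field) p \<sigma>s)
    = pair_multiplicity p {} (set \<sigma>s) (boundaries (set \<sigma>s) p) (UNIV :: ('a list \<Rightarrow> 'k) set)"
proof -
  have "card (immortal_births TYPE('k) p \<sigma>s)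
      = pair_multiplicity p (stage \<sigma>s 0) (stage \<sigma>s (length \<sigma>s))
          (boundaries (set \<sigma>s) p) (UNIV :: ('a list \<Rightarrow> 'k) set)"
    unfolding immortal_births_eq[OF assms]
    by (intro card_births_between assms subspace_boundaries chain.subspace_UNIV subset_UNIV)
      simp_all
  then show ?thesis by (simp add: stage_def)
qed

lemma count_persistence_diagram:
  "count (persistence_diagram TYPE('k::field) p f \<sigma>s) (a, y) =
     (if y = - \<infinity> then card {i \<in> immortal_births TYPE('k) p \<sigma>s. f (\<sigma>s ! (i - 1)) = a}
      else card {(i, j) \<in> finite_pairs TYPE('k) p \<sigma>s.
             f (\<sigma>s ! (i - 1)) = a \<and> ereal (f (\<sigma>s ! (j - 1))) = y})"
proof -
  have 1: "{x \<in> finite_pairs TYPE('k) p \<sigma>s.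
        (case x of (i, j) \<Rightarrow> (f (\<sigma>s ! (i - 1)), ereal (f (\<sigma>s ! (j - 1))))) = (a, y)}
      = {(i, j) \<in> finite_pairs TYPE('k) p \<sigma>s. f (\<sigma>s ! (i - 1)) = a \<and> ereal (f (\<sigma>s ! (j - 1))) = y}"
    by auto
  have 2: "{i \<in> immortal_births TYPE('k) p \<sigma>s. (f (\<sigma>s ! (i - 1)), - \<infinity>) = (a, y)}
      = (if y = - \<infinity> then {i \<in> immortal_births TYPE('k) p \<sigma>s. f (\<sigma>s ! (i - 1)) = a} else {})"
    by auto
  have 3: "{(i, j) \<in> finite_pairs TYPE('k) p \<sigma>s.
      f (\<sigma>s ! (i - 1)) = a \<and> ereal (f (\<sigma>s ! (j - 1))) = - \<infinity>} = {}" by auto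
  show ?thesis
    unfolding persistence_diagram_eq count_union
      count_image_mset_set[OF finite_finite_pairs] count_image_mset_set[OF finite_immortal_births]
      1 2
    using 3 by auto
qed

text \<open>The right-hand sides of \<open>card_finite_pairs_at\<close> and \<open>card_immortal_births_at\<close> depend on the
  order only through the set of its simplices. Points on the diagonal may differ in multiplicity,
  but adding infinitely many copies of each removes this difference.\<close>

lemma with_diagonal_persistence_diagram_cong:
  assumes fin: "finite (\<Union>(set \<sigma>s))" and "set \<tau>s = set \<sigma>s"
    and sorted: "sorted_wrt (\<lambda>\<sigma> \<tau>. f \<sigma> \<ge> f \<tau>) \<sigma>s" "sorted_wrt (\<lambda>\<sigma> \<tau>. f \<sigma> \<ge> f \<tau>) \<tau>s"
  shows "with_diagonal (persistence_diagram TYPE('k::field) p f \<sigma>s)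
    = with_diagonal (persistence_diagram TYPE('k) p f \<tau>s)"
proof -
  have fin': "finite (\<Union>(set \<tau>s))" using assms by simp
  \<comment> \<open>Births precede deaths and the order is decreasing, so no point lies above the diagonal.\<close>
  have above: "{(i, j) \<in> finite_pairs TYPE('k) p \<rho>s.
      f (\<rho>s ! (i - 1)) = a \<and> f (\<rho>s ! (j - 1)) = b} = {}"
    if "sorted_wrt (\<lambda>\<sigma> \<tau>. f \<sigma> \<ge> f \<tau>) \<rho>s" "a < b" for \<rho>s :: "'a set list" and a b
  proof -
    have "f (\<rho>s ! (j - 1)) \<le> f (\<rho>s ! (i - 1))" if "(i, j) \<in> finite_pairs TYPE('k) p \<rho>s" for i j
      using finite_pairs_bounds[OF that] \<open>sorted_wrt _ \<rho>s\<close>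
      by (auto simp: sorted_wrt_iff_nth_less)
    then show ?thesis using that(2) by fastforce
  qed
  have "count (persistence_diagram TYPE('k) p f \<sigma>s) (a, y)
      = count (persistence_diagram TYPE('k) p f \<tau>s) (a, y)" if "y \<noteq> ereal a" for a y
  proof (cases y)
    case (real b)
    have "card {(i, j) \<in> finite_pairs TYPE('k) p \<sigma>s. f (\<sigma>s ! (i - 1)) = a \<and> f (\<sigma>s ! (j - 1)) = b}
        = card {(i, j) \<in> finite_pairs TYPE('k) p \<tau>s. f (\<tau>s ! (i - 1)) = a \<and> f (\<tau>s ! (j - 1)) = b}"
    proof (cases "b < a")
      case True
      show ?thesis
        unfolding card_finite_pairs_at[OF fin sorted(1) True]
          card_finite_pairs_at[OF fin' sorted(2) True] assms(2) ..
    next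
      case False
      then have "a < b" using that real by auto
      then show ?thesis by (simp only: above[OF sorted(1)] above[OF sorted(2)])
    qed
    then show ?thesis unfolding count_persistence_diagram real by simp
  next
    case PInf
    then show ?thesis unfolding count_persistence_diagram by simp
  next
    case MInf
    then show ?thesis
      unfolding count_persistence_diagram card_immortal_births_at[OF fin sorted(1)]
        card_immortal_births_at[OF fin' sorted(2)] assms(2) by simp
  qed
  then show ?thesis unfolding with_diagonal_def by auto
qed

section \<open>Matching diagrams with values in the unit interval\<close>

lemma in_mset_of_lt_count: "n < count M x \<Longrightarrow> x \<in># M"
  using count_eq_zero_iff[of M x] by auto

lemma Collect_lt_count: "{(x, n). n < count M x} = Sigma (set_mset M) (\<lambda>x. {..<count M x})"
  by (auto dest: in_mset_of_lt_count)

lemma finite_lt_count: "finite {(x, n). n < count M x}"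
  unfolding Collect_lt_count by simp

lemma card_lt_count: "card {(x, n). n < count M x} = size M"
  unfolding Collect_lt_count by (simp add: size_multiset_overloaded_eq)

lemma bottleneck_dist_le_of_bij:
  assumes "bij_betw \<eta> (with_diagonal X) (with_diagonal Y)"
    and "\<And>x. x \<in> with_diagonal X \<Longrightarrow> point_dist (fst x) (fst (\<eta> x)) \<le> e"
  shows "bottleneck_dist X Y \<le> e"
  unfolding bottleneck_dist_def
  by (rule INF_lower2[of \<eta>]) (use assms in \<open>auto intro: SUP_least\<close>)

lemma bottleneck_dist_le_0_of_eq:
  assumes "with_diagonal X = with_diagonal Y"
  shows "bottleneck_dist X Y \<le> 0"
  by (rule bottleneck_dist_le_of_bij[of id]) (simp_all add: assms point_dist_def)

lemma point_dist_unit_interval_le_1: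
  assumes "0 \<le> a" "a \<le> 1" "0 \<le> a'" "a' \<le> 1"
  shows "point_dist (a, - \<infinity>) (a', - \<infinity>) \<le> 1"
    and "0 \<le> b \<Longrightarrow> b \<le> 1 \<Longrightarrow> 0 \<le> b' \<Longrightarrow> b' \<le> 1 \<Longrightarrow>
      point_dist (a, ereal b) (a', ereal b') \<le> 1"
  using assms unfolding point_dist_def by (auto simp: one_ereal_def)

definition in_unit_box :: "real \<times> ereal \<Rightarrow> bool" where
  "in_unit_box x \<longleftrightarrow> 0 \<le> fst x \<and> fst x \<le> 1 \<and> (snd x = - \<infinity> \<or> 0 \<le> snd x \<and> snd x \<le> 1)"

text \<open>After adjoining infinitely many copies of \<open>(0, 0)\<close>, the finite off-diagonal points of
  either diagram form a countably infinite subset of the unit square, and any bijection between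
  two such sets moves points by at most \<open>1\<close>. The remaining diagonal points stay where they are.\<close>

lemma bottleneck_dist_le_1:
  assumes X: "\<And>x. x \<in># X \<Longrightarrow> in_unit_box x"
    and Y: "\<And>x. x \<in># Y \<Longrightarrow> in_unit_box x"
    and size: "size {#x \<in># X. snd x = - \<infinity>#} = size {#x \<in># Y. snd x = - \<infinity>#}"
  shows "bottleneck_dist X Y \<le> 1"
proof -
  \<comment> \<open>\<open>Im\<close>: the points at infinity; \<open>Fn\<close>: the finite off-diagonal points and the copies of the
    origin; \<open>Dg\<close>: the rest of the diagonal, common to both diagrams.\<close>
  define Im where "Im M = {(x, n). n < count {#x \<in># M. snd x = - \<infinity>#} x}"
    for M :: "(real \<times> ereal) multiset"
  define D0 :: "((real \<times> ereal) \<times> nat) set" where "D0 = {(0, 0)} \<times> UNIV"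
  define Fn where "Fn M = {(x, n). n < count M x \<and> snd x \<noteq> - \<infinity> \<and> snd x \<noteq> ereal (fst x)} \<union> D0"
    for M :: "(real \<times> ereal) multiset"
  define Dg :: "((real \<times> ereal) \<times> nat) set"
    where "Dg = {(x, n). snd x = ereal (fst x)} - D0"
  have split: "with_diagonal M = Im M \<union> Fn M \<union> Dg" for M
    unfolding with_diagonal_def Im_def Fn_def Dg_def D0_def
    by (auto simp: zero_ereal_def zero_prod_def split: if_splits)
  have disj: "Im M \<inter> Fn M = {}" "(Im M \<union> Fn M) \<inter> Dg = {}" for M
    unfolding Im_def Fn_def Dg_def D0_def by (auto split: if_splits)
  obtain g where g: "bij_betw g (Im X) (Im Y)"
  proof -
    have "finite (Im X)" "finite (Im Y)" "card (Im X) = card (Im Y)"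
      unfolding Im_def by (simp_all only: finite_lt_count card_lt_count size)
    then show thesis using finite_same_card_bij that by blast
  qed
  have Fn: "countable (Fn M)" "infinite (Fn M)" for M
  proof -
    have "finite {(x, n). n < count M x \<and> snd x \<noteq> - \<infinity> \<and> snd x \<noteq> ereal (fst x)}"
      by (rule finite_subset[OF _ finite_lt_count[of M]]) auto
    then show "countable (Fn M)" unfolding Fn_def D0_def by (simp add: countable_finite)
    have "infinite D0" unfolding D0_def by (simp add: finite_cartesian_product_iff)
    then show "infinite (Fn M)" unfolding Fn_def by simp
  qed
  obtain h where h: "bij_betw h (Fn X) (Fn Y)"
  proof -
    from Fn obtain u v :: "(real \<times> ereal) \<times> nat \<Rightarrow> nat"
      where "bij_betw u (Fn X) UNIV" "bij_betw v (Fn Y) UNIV"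
      by (meson countableE_infinite)
    then have "bij_betw (inv_into (Fn Y) v \<circ> u) (Fn X) (Fn Y)"
      by (blast intro: bij_betw_trans bij_betw_inv_into)
    then show thesis by (rule that)
  qed
  define \<eta> where "\<eta> x = (if x \<in> Im X then g x else if x \<in> Fn X then h x else x)" for x
  show ?thesis
  proof (rule bottleneck_dist_le_of_bij)
    have "bij_betw \<eta> (Im X) (Im Y)"
      using g by (rule bij_betw_cong[THEN iffD1, rotated]) (simp add: \<eta>_def)
    moreover have "bij_betw \<eta> (Fn X) (Fn Y)"
      using h by (rule bij_betw_cong[THEN iffD1, rotated]) (use disj in \<open>auto simp: \<eta>_def\<close>)
    moreover have "bij_betw \<eta> Dg Dg"
      using bij_betw_id by (rule bij_betw_cong[THEN iffD1, rotated]) (use disj in \<open>auto simp: \<eta>_def\<close>)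
    ultimately show "bij_betw \<eta> (with_diagonal X) (with_diagonal Y)"
      unfolding split using disj by (intro bij_betw_combine) auto
  next
    fix x assume "x \<in> with_diagonal X"
    then consider "x \<in> Im X" | "x \<notin> Im X" "x \<in> Fn X" | "x \<notin> Im X" "x \<notin> Fn X"
      by blast
    then show "point_dist (fst x) (fst (\<eta> x)) \<le> 1"
    proof cases
      case 1
      have Im: "0 \<le> fst (fst x) \<and> fst (fst x) \<le> 1 \<and> snd (fst x) = - \<infinity>"
        if "x \<in> Im M" and M: "\<And>x. x \<in># M \<Longrightarrow> in_unit_box x"
        for x M
      proof -
        have "fst x \<in># {#x \<in># M. snd x = - \<infinity>#}"
          using that(1) unfolding Im_def by (auto intro!: in_mset_of_lt_count split: if_splits)
        then show ?thesis using M[of "fst x"] by (auto simp: in_unit_box_def)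
      qed
      have "\<eta> x \<in> Im Y" using 1 g by (auto simp: \<eta>_def bij_betw_def)
      then show ?thesis
        using Im[OF 1 X] Im[OF _ Y, of "\<eta> x"] point_dist_unit_interval_le_1(1)
        by (metis prod.collapse)
    next
      case 2
      have Fn: "\<exists>a b. fst x = (a, ereal b) \<and> 0 \<le> a \<and> a \<le> 1 \<and> 0 \<le> b \<and> b \<le> 1"
        if "x \<in> Fn M" and M: "\<And>x. x \<in># M \<Longrightarrow> in_unit_box x"
        for x M
      proof (cases "x \<in> D0")
        case True
        then have "fst x = (0, ereal 0)" by (auto simp: D0_def zero_ereal_def)
        then show ?thesis by auto
      next
        case False
        then have "fst x \<in># M" "snd (fst x) \<noteq> - \<infinity>"
          using that(1) unfolding Fn_def by (auto dest: in_mset_of_lt_count)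
        then have *: "0 \<le> fst (fst x)" "fst (fst x) \<le> 1" "0 \<le> snd (fst x)" "snd (fst x) \<le> 1"
          using M[of "fst x"] by (auto simp: in_unit_box_def)
        then obtain b where "snd (fst x) = ereal b" by (cases "snd (fst x)") auto
        then show ?thesis
          using * by (intro exI[of _ "fst (fst x)"] exI[of _ b]) (simp add: prod_eq_iff)
      qed
      have "\<eta> x \<in> Fn Y" using 2 h by (auto simp: \<eta>_def bij_betw_def)
      then show ?thesis
        using Fn[OF 2(2) X] Fn[OF _ Y, of "\<eta> x"] point_dist_unit_interval_le_1(2) by fastforce
    next
      case 3
      then show ?thesis by (simp add: \<eta>_def point_dist_def)
    qed
  qed
qed

lemma persistence_diagram_in_unit_interval:
  assumes f: "\<And>\<sigma>. \<sigma> \<in> set \<sigma>s \<Longrightarrow> 0 \<le> f \<sigma> \<and> f \<sigma> \<le> 1"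
    and x: "x \<in># persistence_diagram TYPE('k::field) p f \<sigma>s"
  shows "in_unit_box x"
proof -
  have nth: "0 \<le> f (\<sigma>s ! (i - 1)) \<and> f (\<sigma>s ! (i - 1)) \<le> 1" if "1 \<le> i" "i \<le> length \<sigma>s" for i
    using f nth_mem[of "i - 1" \<sigma>s] that by simp
  from x consider i j where "(i, j) \<in> finite_pairs TYPE('k) p \<sigma>s"
      "x = (f (\<sigma>s ! (i - 1)), ereal (f (\<sigma>s ! (j - 1))))"
    | i where "i \<in> immortal_births TYPE('k) p \<sigma>s" "x = (f (\<sigma>s ! (i - 1)), - \<infinity>)"
    unfolding persistence_diagram_eq by (auto simp: finite_finite_pairs finite_immortal_births)
  then show ?thesis
  proof cases
    case 1
    then show ?thesis
      using finite_pairs_bounds[OF 1(1)] nth[of i] nth[of j] by (simp add: in_unit_box_def)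
  next
    case 2
    then show ?thesis using immortal_births_bounds[OF 2(1)] nth[of i] by (simp add: in_unit_box_def)
  qed
qed

lemma size_infinite_points:
  "size {#x \<in># persistence_diagram TYPE('k::field) p f \<sigma>s. snd x = - \<infinity>#}
    = card (immortal_births TYPE('k) p \<sigma>s)"
proof -
  have "{#x \<in># persistence_diagram TYPE('k) p f \<sigma>s. snd x = - \<infinity>#}
      = image_mset (\<lambda>i. (f (\<sigma>s ! (i - 1)), - \<infinity>)) (mset_set (immortal_births TYPE('k) p \<sigma>s))"
    unfolding persistence_diagram_eq
    by (simp add: filter_mset_image_mset case_prod_unfold)
  then show ?thesis by simp
qed

section \<open>The cliqueness filtration\<close>

lemma cliqueness_edge_in_unit_interval:
  assumes "pair_graph G" "e \<in> complete_edges (pverts G)"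
  shows "0 \<le> cliqueness_edge G e \<and> cliqueness_edge G e \<le> 1"
proof -
  interpret pair_graph G by fact
  have fin: "finite (closed_nbhd G v)" for v
  proof -
    have "{w. (v, w) \<in> parcs G} \<subseteq> snd ` parcs G" by force
    then show ?thesis
      unfolding closed_nbhd_def using finite_subset[OF _ finite_imageI[OF finite_arcs]] by simp
  qed
  have e: "e \<noteq> {}" "finite e" using assms(2) by (auto simp: complete_edges_def)
  then have "card (\<Inter>v\<in>e. closed_nbhd G v) \<le> card (\<Union>v\<in>e. closed_nbhd G v)"
    using fin by (intro card_mono) auto
  then show ?thesis unfolding cliqueness_edge_def by (auto simp: divide_le_eq_1)
qed

lemma finite_complete_edges: "finite V \<Longrightarrow> finite (complete_edges V)"
  by (rule finite_subset[of _ "Pow V"]) (auto simp: complete_edges_def)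

lemma cliqueness_in_unit_interval:
  assumes G: "pair_graph G" and \<sigma>: "\<sigma> \<in> full_complex (pverts G)"
  shows "0 \<le> cliqueness G \<sigma> \<and> cliqueness G \<sigma> \<le> 1"
proof -
  interpret pair_graph G by fact
  let ?C = "cliqueness_edge G"
  have fin: "finite (?C ` {e \<in> complete_edges (pverts G). Q e})" for Q
    using finite_complete_edges[OF finite_verts] by simp
  have unit: "0 \<le> y \<and> y \<le> 1" if "y \<in> ?C ` {e \<in> complete_edges (pverts G). Q e}" for y Q
    using that cliqueness_edge_in_unit_interval[OF G] by auto
  show ?thesis
  proof (cases "card \<sigma> \<ge> 2")
    case True
    then obtain v w where "v \<in> \<sigma>" "w \<in> \<sigma>" "v \<noteq> w"
      by (metis card_2_iff' obtain_subset_with_card_n subsetD)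
    then have "{v, w} \<in> {e \<in> complete_edges (pverts G). e \<subseteq> \<sigma>}"
      using \<sigma> by (auto simp: complete_edges_def full_complex_def)
    then have "?C ` {e \<in> complete_edges (pverts G). e \<subseteq> \<sigma>} \<noteq> {}" by blast
    from unit[OF Min_in[OF fin this]] show ?thesis using True by (simp add: cliqueness_def)
  next
    case False
    show ?thesis
    proof (cases "{e \<in> complete_edges (pverts G). \<sigma> \<subseteq> e} = {}")
      case True
      then show ?thesis using False by (simp add: cliqueness_def)
    next
      case nonempty: False
      then have "?C ` {e \<in> complete_edges (pverts G). \<sigma> \<subseteq> e} \<noteq> {}" by blast
      from unit[OF Max_in[OF fin this]] show ?thesis
        using False nonempty by (simp add: cliqueness_def)
    qed
  qed
qed

lemma cliqueness_order_sorted: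
  "cliqueness_order G \<sigma>s \<Longrightarrow> sorted_wrt (\<lambda>\<sigma> \<tau>. cliqueness G \<sigma> \<ge> cliqueness G \<tau>) \<sigma>s"
  unfolding cliqueness_order_def by (auto elim: sorted_wrt_mono_rel[rotated])

lemma graph_dist_cases:
  assumes "pair_graph G" "pair_graph H" "pverts G = pverts H" "pverts G \<noteq> {}"
  shows "graph_dist G H = 1 \<or> G = H \<and> graph_dist G H = 0"
proof -
  interpret G: pair_graph G by fact
  interpret H: pair_graph H by fact
  let ?d = "\<lambda>i j. \<bar>indicator (parcs G) (i, j) - indicator (parcs H) (i, j)\<bar> :: real"
  let ?D = "{?d i j | i j. i \<in> pverts G \<and> j \<in> pverts G}"
  have D: "?D = (\<lambda>(i, j). ?d i j) ` (pverts G \<times> pverts G)" by auto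
  have fin: "finite ?D" unfolding D using G.finite_verts by simp
  have "?D \<noteq> {}" using assms(4) by auto
  have "?d i j \<in> {0, 1}" for i j by (auto simp: indicator_def)
  then have "?D \<subseteq> {0, 1}" by blast
  then have "graph_dist G H \<in> {0, 1}"
    unfolding graph_dist_def using Max_in[OF fin \<open>?D \<noteq> {}\<close>] by blast
  moreover have "G = H" if "graph_dist G H = 0"
  proof -
    have arcs: "(i, j) \<in> parcs G \<longleftrightarrow> (i, j) \<in> parcs H" if "i \<in> pverts G" "j \<in> pverts G" for i j
    proof -
      have "?d i j \<le> graph_dist G H"
        unfolding graph_dist_def using that by (intro Max_ge[OF fin]) auto
      then show ?thesis using \<open>graph_dist G H = 0\<close> by (auto simp: indicator_def split: if_splits)
    qed
    have "parcs G = parcs H"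
    proof (intro set_eqI)
      fix e
      show "e \<in> parcs G \<longleftrightarrow> e \<in> parcs H"
        using arcs[of "fst e" "snd e"] G.arc_fst_in_verts[of e] G.arc_snd_in_verts[of e]
          H.arc_fst_in_verts[of e] H.arc_snd_in_verts[of e] assms(3) by auto
    qed
    then show ?thesis using assms(3) by simp
  qed
  ultimately show ?thesis by auto
qed

theorem theorem3:
  fixes V :: "'a set" and G1 G2 :: "'a pair_pre_digraph"
    and \<sigma>s \<tau>s :: "'a set list" and p :: nat
    and P1 P2 :: "(real \<times> ereal) multiset"
  assumes "finite V" and "V \<noteq> {}"
    and "pair_graph G1" and "pverts G1 = V"
    and "pair_graph G2" and "pverts G2 = V"
    and "cliqueness_order G1 \<sigma>s" and "cliqueness_order G2 \<tau>s"
    and "P1 = persistence_diagram TYPE('k::field) p (cliqueness G1) \<sigma>s"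
    and "P2 = persistence_diagram TYPE('k::field) p (cliqueness G2) \<tau>s"
  shows "bottleneck_dist P1 P2 \<le> ereal (graph_dist G1 G2)"
proof -
  have sets: "set \<sigma>s = full_complex V" "set \<tau>s = full_complex V"
    using assms unfolding cliqueness_order_def by auto
  have "\<Union>(full_complex V) \<subseteq> V" by (auto simp: full_complex_def)
  then have fin: "finite (\<Union>(set \<sigma>s))" "finite (\<Union>(set \<tau>s))"
    unfolding sets using \<open>finite V\<close> by (auto intro: finite_subset)
  note sorted = cliqueness_order_sorted[OF assms(7)] cliqueness_order_sorted[OF assms(8)]
  from graph_dist_cases[OF assms(3,5)] assms(2,4,6)
  consider "graph_dist G1 G2 = 1" | "G1 = G2" "graph_dist G1 G2 = 0" by auto
  then show ?thesis
  proof cases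
    case 1
    have "bottleneck_dist P1 P2 \<le> 1"
    proof (rule bottleneck_dist_le_1)
      show "size {#x \<in># P1. snd x = - \<infinity>#} = size {#x \<in># P2. snd x = - \<infinity>#}"
        unfolding assms(9,10) size_infinite_points card_immortal_births[OF fin(1)]
          card_immortal_births[OF fin(2)] sets ..
    next
      fix x assume "x \<in># P1"
      then show "in_unit_box x"
        unfolding assms(9) by (rule persistence_diagram_in_unit_interval[rotated])
          (use cliqueness_in_unit_interval[OF assms(3)] sets assms(4) in simp)
    next
      fix x assume "x \<in># P2"
      then show "in_unit_box x"
        unfolding assms(10) by (rule persistence_diagram_in_unit_interval[rotated])
          (use cliqueness_in_unit_interval[OF assms(5)] sets assms(6) in simp)
    qed
    then show ?thesis using 1 by (simp add: one_ereal_def)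
  next
    case 2
    have "with_diagonal P1 = with_diagonal P2"
      unfolding assms(9,10) \<open>G1 = G2\<close>
      by (rule with_diagonal_persistence_diagram_cong)
        (use fin sets sorted \<open>G1 = G2\<close> in simp_all)
    then have "bottleneck_dist P1 P2 \<le> 0" by (rule bottleneck_dist_le_0_of_eq)
    then show ?thesis using 2 by (simp add: zero_ereal_def)
  qed
qed

end
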